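(* Let $A,B,C\in\mathbb{P}^2$ be non-collinear points, ordered such that $\varphi_{AB}\le\varphi_{AC}\le\varphi_{BC}$, and let $\mathscr{P}_{ABC}\subset\mathbb{P}^2$ be the set of global minimizers over $P\in\mathbb{P}^2$ of $\mathcal{J}_{ABC}(P)=d_{\mathbb{P}^2}(A,P)+d_{\mathbb{P}^2}(B,P)+d_{\mathbb{P}^2}(C,P)$. (1) If $60^\circ\le\varphi_{AB}\le\varphi_{AC}<\varphi_{BC}$, then $\mathscr{P}_{ABC}=\{A\}$. (2) If $60^\circ\le\varphi_{AB}<\varphi_{AC}=\varphi_{BC}$, then $\mathscr{P}_{ABC}=\{A,B\}$. (3) If $\varphi_{AB}=\varphi_{AC}=\varphi_{BC}=\varphi$, then: (a) if $\varphi>60^\circ$, then $\mathscr{P}_{ABC}=\{A,B,C\}$; (b) if $\varphi=60^\circ$, then $\mathscr{P}_{ABC}=\{A,B,C,E\}$; (c) if $\varphi<60^\circ$, then $\mathscr{P}_{ABC}=\{E\}$, where, in (b) and (c), $E\in\mathbb{P}^2$ is the point representing the centroid line $\ell_E$ of the three equiangular lines $\ell_A,\ell_B,\ell_C$.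
   Context: $\mathbb{P}^2$ is the real projective plane; a point $P\in\mathbb{P}^2$ represents a line $\ell_P$ through the origin in $\mathbb{R}^3$. For $P_1,P_2\in\mathbb{P}^2$, $\varphi_{P_1P_2}\in[0,90^\circ]$ is the smallest angle between $\ell_{P_1}$ and $\ell_{P_2}$, and $d_{\mathbb{P}^2}(P_1,P_2)=\sin\varphi_{P_1P_2}$. Non-collinear means that unit vectors spanning $\ell_A,\ell_B,\ell_C$ are linearly independent. Centroid: in the equiangular case with $\varphi\le 60^\circ$, one can choose unit vectors $a,b,c$ spanning $\ell_A,\ell_B,\ell_C$ with $a^\top b=a^\top c=b^\top c=\cos\varphi>0$; the centroid $\ell_E$ is the line spanned by $e=(a+b+c)/\|a+b+c\|_2$. *)

theory Defs
  imports "HOL-Analysis.Analysis"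
begin

typedef proj_plane = "{L :: (real^3) set. subspace L \<and> dim L = 1}"
  morphisms line_of Abs_proj_plane
proof -
  have "subspace (span {axis 1 1 :: real^3})" "dim (span {axis 1 1 :: real^3}) = 1"
    by (simp_all add: dim_span axis_eq_0_iff)
  then show ?thesis by blast
qed

definition unit_rep :: "proj_plane \<Rightarrow> real^3 \<Rightarrow> bool" where
  "unit_rep P u \<longleftrightarrow> norm u = 1 \<and> line_of P = span {u}"

text \<open>The set below has the form \<open>{t, pi - t}\<close>; see \<open>proj_angle_eq\<close>.
  Angles are in radians.\<close>

definition proj_angle :: "proj_plane \<Rightarrow> proj_plane \<Rightarrow> real" where
  "proj_angle P Q = Inf {arccos (u \<bullet> v) | u v. unit_rep P u \<and> unit_rep Q v}"

definition proj_dist :: "proj_plane \<Rightarrow> proj_plane \<Rightarrow> real" where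
  "proj_dist P Q = sin (proj_angle P Q)"

text \<open>Distinctness is required because \<open>independent\<close> is a predicate on sets and
  \<open>{a, b, c}\<close> collapses repeated vectors.\<close>

definition noncollinear :: "proj_plane \<Rightarrow> proj_plane \<Rightarrow> proj_plane \<Rightarrow> bool" where
  "noncollinear A B C \<longleftrightarrow>
    (\<exists>a b c. unit_rep A a \<and> unit_rep B b \<and> unit_rep C c \<and>
      distinct [a, b, c] \<and> independent {a, b, c})"

definition cost :: "proj_plane \<Rightarrow> proj_plane \<Rightarrow> proj_plane \<Rightarrow> proj_plane \<Rightarrow> real" where
  "cost A B C P = proj_dist A P + proj_dist B P + proj_dist C P"

definition minimizers :: "proj_plane \<Rightarrow> proj_plane \<Rightarrow> proj_plane \<Rightarrow> proj_plane set" where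
  "minimizers A B C = {P. \<forall>Q. cost A B C P \<le> cost A B C Q}"

definition is_centroid :: "proj_plane \<Rightarrow> proj_plane \<Rightarrow> proj_plane \<Rightarrow> proj_plane \<Rightarrow> bool" where
  "is_centroid A B C E \<longleftrightarrow>
    (\<exists>a b c. unit_rep A a \<and> unit_rep B b \<and> unit_rep C c \<and>
      a \<bullet> b = cos (proj_angle A B) \<and> a \<bullet> c = cos (proj_angle A B) \<and>
      b \<bullet> c = cos (proj_angle A B) \<and> cos (proj_angle A B) > 0 \<and>
      line_of E = span {(a + b + c) /\<^sub>R norm (a + b + c)})"

text \<open>Meaningful only for equiangular noncollinear points at angle at most \<open>pi / 3\<close>,
  where \<open>is_centroid_ex1\<close> gives existence and uniqueness.\<close>

definition centroid :: "proj_plane \<Rightarrow> proj_plane \<Rightarrow> proj_plane \<Rightarrow> proj_plane" where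
  "centroid A B C = (THE E. is_centroid A B C E)"

lemma unit_rep_exists: "\<exists>u. unit_rep P u"
proof -
  have L: "subspace (line_of P)" "dim (line_of P) = 1"
    using line_of[of P] by auto
  obtain B where B: "B \<subseteq> line_of P" "independent B" "line_of P \<subseteq> span B" "card B = 1"
    using basis_exists[of "line_of P"] L by metis
  then obtain x where x: "B = {x}" by (auto simp: card_1_singleton_iff)
  have "x \<noteq> 0" using B x dependent_zero by auto
  have "line_of P = span {x}"
    using B x L by (metis span_subspace)
  also have "\<dots> = span {x /\<^sub>R norm x}"
    using \<open>x \<noteq> 0\<close> span_image_scale[of "{x}" "\<lambda>_. inverse (norm x)"] by simp
  finally show ?thesis
    unfolding unit_rep_def using \<open>x \<noteq> 0\<close> by (intro exI[of _ "x /\<^sub>R norm x"]) auto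
qed

lemma unit_rep_iff:
  assumes "unit_rep P u"
  shows "unit_rep P v \<longleftrightarrow> v = u \<or> v = - u"
proof
  assume v: "unit_rep P v"
  then have "v \<in> span {u}" using assms unfolding unit_rep_def by (metis insertI1 span_base)
  then obtain k where k: "v = k *\<^sub>R u" by (auto simp: span_singleton)
  have "\<bar>k\<bar> = 1" using k assms v unfolding unit_rep_def by simp
  then show "v = u \<or> v = - u" using k by (auto simp: abs_if split: if_splits)
next
  have "span {- u} = span {u}"
    using span_image_scale[of "{u}" "\<lambda>_. -1"] by simp
  then show "v = u \<or> v = - u \<Longrightarrow> unit_rep P v"
    using assms unfolding unit_rep_def by auto
qed

lemma unit_rep_inner_bound:
  assumes "unit_rep P u" "unit_rep Q v"
  shows "\<bar>u \<bullet> v\<bar> \<le> 1"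
  using Cauchy_Schwarz_ineq2[of u v] assms unfolding unit_rep_def by simp

lemma proj_angle_eq:
  assumes u: "unit_rep P u" and v: "unit_rep Q v"
  shows "proj_angle P Q = arccos \<bar>u \<bullet> v\<bar>"
proof -
  have S: "{arccos (x \<bullet> y) | x y. unit_rep P x \<and> unit_rep Q y}
      = {arccos (u \<bullet> v), arccos (- (u \<bullet> v))}"
    unfolding unit_rep_iff[OF u] unit_rep_iff[OF v] by auto (metis inner_minus_left)
  have b: "\<bar>u \<bullet> v\<bar> \<le> 1" by (rule unit_rep_inner_bound[OF u v])
  have "min (arccos (u \<bullet> v)) (arccos (- (u \<bullet> v))) = arccos \<bar>u \<bullet> v\<bar>"
    using b arccos_le_arccos[of "- (u \<bullet> v)" "u \<bullet> v"] arccos_le_arccos[of "u \<bullet> v" "- (u \<bullet> v)"]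
    by (auto simp: abs_if min_def)
  then show ?thesis
    unfolding proj_angle_def S by (simp add: cInf_eq_Min)
qed

lemma proj_angle_bounds: "0 \<le> proj_angle P Q" "proj_angle P Q \<le> pi / 2"
proof -
  obtain u v where uv: "unit_rep P u" "unit_rep Q v" using unit_rep_exists by metis
  show "0 \<le> proj_angle P Q" "proj_angle P Q \<le> pi / 2"
    unfolding proj_angle_eq[OF uv] using unit_rep_inner_bound[OF uv]
    by (auto intro!: arccos_lbound arccos_le_pi2 simp del: le_divide_eq_numeral1)
qed

lemma cos_proj_angle:
  assumes "unit_rep P u" "unit_rep Q v"
  shows "cos (proj_angle P Q) = \<bar>u \<bullet> v\<bar>"
  using unit_rep_inner_bound[OF assms] proj_angle_eq[OF assms] by simp

lemma is_centroid_ex1: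
  assumes nc: "noncollinear A B C"
    and eq: "proj_angle A B = proj_angle A C" "proj_angle A C = proj_angle B C"
    and le: "proj_angle A B \<le> pi / 3"
  shows "\<exists>!E. is_centroid A B C E"
proof -
  obtain a b c where abc: "unit_rep A a" "unit_rep B b" "unit_rep C c"
      "distinct [a, b, c]" "independent {a, b, c}"
    using nc unfolding noncollinear_def by blast
  define k where "k = cos (proj_angle A B)"
  have k: "k \<ge> 1/2"
    using cos_monotone_0_pi_le[of "proj_angle A B" "pi/3"] le proj_angle_bounds[of A B]
    unfolding k_def by (simp add: cos_60)
  have sq: "a \<bullet> a = 1" "b \<bullet> b = 1" "c \<bullet> c = 1"
    using abc unfolding unit_rep_def by (simp_all add: dot_square_norm)
  have ks: "\<bar>a \<bullet> b\<bar> = k" "\<bar>a \<bullet> c\<bar> = k" "\<bar>b \<bullet> c\<bar> = k"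
    using cos_proj_angle abc eq unfolding k_def by metis+
  have comb: False if "x *\<^sub>R a + y *\<^sub>R b + z *\<^sub>R c = 0" "x \<noteq> 0" for x y z
  proof -
    have "a = (- y / x) *\<^sub>R b + (- z / x) *\<^sub>R c"
    proof -
      have "x *\<^sub>R a = - y *\<^sub>R b - z *\<^sub>R c" using that(1)
        by (simp add: algebra_simps eq_neg_iff_add_eq_0)
      then have "(1/x) *\<^sub>R (x *\<^sub>R a) = (1/x) *\<^sub>R (- y *\<^sub>R b - z *\<^sub>R c)" by simp
      then show ?thesis using that(2) by (simp add: scaleR_diff_right)
    qed
    then have "a \<in> span {b, c}"
      by (metis insertI1 insertI2 span_add span_base span_scale)
    moreover have "{a, b, c} - {a} = {b, c}" using abc(4) by auto
    ultimately show False using abc(5) unfolding dependent_def by auto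
  qed
  have pos: "(a \<bullet> b) * (a \<bullet> c) * (b \<bullet> c) > 0"
  proof (rule ccontr)
    assume np: "\<not> ?thesis"
    define s where "s = sgn (a \<bullet> b)"
    define t where "t = sgn (a \<bullet> c)"
    have nz: "a \<bullet> b \<noteq> 0" "a \<bullet> c \<noteq> 0" "b \<bullet> c \<noteq> 0" using ks k by auto
    have st: "\<bar>s\<bar> = 1" "\<bar>t\<bar> = 1" using nz by (auto simp: s_def t_def abs_sgn_eq)
    have ab: "a \<bullet> b = s * k" "a \<bullet> c = t * k"
      using sgn_mult_abs[of "a \<bullet> b"] sgn_mult_abs[of "a \<bullet> c"] ks
      unfolding s_def t_def by metis+
    have st2: "s * s = 1" "t * t = 1" using st by (auto simp: abs_if split: if_splits)
    have bc: "b \<bullet> c = - (s * t * k)"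
    proof -
      have "(a \<bullet> b) * (a \<bullet> c) * (b \<bullet> c) = (k * k) * ((s * t) * (b \<bullet> c))"
        unfolding ab by (simp add: algebra_simps)
      then have "(k * k) * ((s * t) * (b \<bullet> c)) \<le> 0" using np by linarith
      then have "(s * t) * (b \<bullet> c) \<le> 0" using k by (simp add: mult_le_0_iff)
      moreover have "s * t = 1 \<or> s * t = -1" using st by (auto simp: abs_if split: if_splits)
      ultimately show ?thesis using ks(3) by (auto simp: abs_if split: if_splits)
    qed
    define w where "w = a - s *\<^sub>R b - t *\<^sub>R c"
    have "w \<bullet> w = a \<bullet> a + (s * s) * (b \<bullet> b) + (t * t) * (c \<bullet> c)
        - 2 * s * (a \<bullet> b) - 2 * t * (a \<bullet> c) + 2 * s * t * (b \<bullet> c)"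
      unfolding w_def by (simp add: inner_diff_left inner_diff_right inner_commute algebra_simps)
    also have "\<dots> = 3 - 2 * (s * s) * k - 2 * (t * t) * k - 2 * ((s * s) * (t * t)) * k"
      unfolding sq ab bc st2 using st2 by algebra
    also have "\<dots> = 3 - 6 * k" unfolding st2 by simp
    finally have "w \<bullet> w \<le> 0" using k by simp
    then have "w = 0" using inner_gt_zero_iff[of w] by fastforce
    then show False using comb[of 1 "- s" "- t"] by (simp add: w_def)
  qed
  have "\<exists>b' c'. unit_rep B b' \<and> unit_rep C c' \<and> a \<bullet> b' = k \<and> a \<bullet> c' = k \<and> b' \<bullet> c' = k"
  proof -
    define s where "s = sgn (a \<bullet> b)"
    define t where "t = sgn (a \<bullet> c)"
    have nz: "a \<bullet> b \<noteq> 0" "a \<bullet> c \<noteq> 0" "b \<bullet> c \<noteq> 0" using ks k by auto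
    have "s = 1 \<or> s = -1" "t = 1 \<or> t = -1" using nz by (auto simp: s_def t_def sgn_if)
    then have "unit_rep B (s *\<^sub>R b)" "unit_rep C (t *\<^sub>R c)"
      using unit_rep_iff[OF abc(2)] unit_rep_iff[OF abc(3)] by auto
    moreover have "a \<bullet> (s *\<^sub>R b) = k" "a \<bullet> (t *\<^sub>R c) = k"
      using ks by (auto simp: s_def t_def sgn_if)
    moreover have "(s *\<^sub>R b) \<bullet> (t *\<^sub>R c) = k"
      using ks pos by (auto simp: s_def t_def sgn_if zero_less_mult_iff)
    ultimately show ?thesis by blast
  qed
  then obtain b' c' where r: "unit_rep B b'" "unit_rep C c'"
      "a \<bullet> b' = k" "a \<bullet> c' = k" "b' \<bullet> c' = k" by blast
  define e where "e = a + b' + c'"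
  have "e \<noteq> 0"
  proof
    assume "e = 0"
    then have "a \<bullet> e = 0" by simp
    then show False using sq r k by (simp add: e_def inner_add_right)
  qed
  define E where "E = Abs_proj_plane (span {e /\<^sub>R norm e})"
  have E: "line_of E = span {e /\<^sub>R norm e}"
    unfolding E_def using \<open>e \<noteq> 0\<close> by (subst Abs_proj_plane_inverse) auto
  have ex: "is_centroid A B C E"
    unfolding is_centroid_def k_def[symmetric]
  proof (intro exI conjI)
    show "unit_rep A a" "unit_rep B b'" "unit_rep C c'"
        "a \<bullet> b' = k" "a \<bullet> c' = k" "b' \<bullet> c' = k" by fact+
    show "k > 0" using k by simp
    show "line_of E = span {(a + b' + c') /\<^sub>R norm (a + b' + c')}"
      using E unfolding e_def .
  qed
  have "F = E" if "is_centroid A B C F" for F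
  proof -
    from that obtain x y z where xyz: "unit_rep A x" "unit_rep B y" "unit_rep C z"
        "x \<bullet> y = k" "x \<bullet> z = k"
        and F: "line_of F = span {(x + y + z) /\<^sub>R norm (x + y + z)}"
      unfolding is_centroid_def k_def by blast
    have "x = a \<or> x = - a" "y = b' \<or> y = - b'" "z = c' \<or> z = - c'"
      using unit_rep_iff abc(1) r(1,2) xyz(1-3) by blast+
    then have "(x = a \<and> y = b' \<and> z = c') \<or> (x = - a \<and> y = - b' \<and> z = - c')"
      using r(3,4) xyz(4,5) k by auto
    then have "x + y + z = e \<or> x + y + z = - e" by (auto simp: e_def)
    moreover have "span {- (e /\<^sub>R norm e)} = span {e /\<^sub>R norm e}"
      using span_image_scale[of "{e /\<^sub>R norm e}" "\<lambda>_. -1"] by simp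
    ultimately have "line_of F = line_of E" using F E by auto
    then show ?thesis by (simp add: line_of_inject)
  qed
  with ex show ?thesis by blast
qed

end

theory Submission imports Defs begin

text \<open>
  Choose unit vectors \<open>a\<close>, \<open>b\<close>, \<open>c\<close>, \<open>p\<close> spanning the lines of \<open>A\<close>, \<open>B\<close>, \<open>C\<close>, \<open>P\<close>. The distance
  from \<open>A\<close> to \<open>P\<close> is \<open>sqrt (1 - (a \<bullet> p)\<^sup>2)\<close>, so the cost is a continuous function of \<open>p\<close> on the unit
  sphere, and it has a minimizer.

  Angles of at least 60 degrees. Let \<open>P\<close> be a minimizer other than \<open>A\<close>, \<open>B\<close>, \<open>C\<close>. The cost is smooth
  at \<open>P\<close>, so its gradient vanishes there (\<open>minimizer_is_stationary\<close>). With signs chosen such that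
  \<open>a \<bullet> p\<close>, \<open>b \<bullet> p\<close>, \<open>c \<bullet> p\<close> are nonnegative, this means that three tangent vectors at \<open>P\<close>, pointing
  towards the vertices and of these lengths, add up to zero. They form the sides of a triangle, so
  the law of cosines ties the inner products of \<open>a\<close>, \<open>b\<close>, \<open>c\<close> to the three lengths. The problem is
  left with three parameters, the distances \<open>r \<le> s \<le> t\<close> from \<open>P\<close> to the vertices. Name the
  vertices so that these belong to \<open>A\<close>, \<open>B\<close>, \<open>C\<close> in this order. With \<open>\<theta> = (1 + t\<^sup>2 - s\<^sup>2)/2\<close>
  the side \<open>AB\<close> is at most \<open>s + \<theta> r\<close> and the side \<open>AC\<close> at most \<open>t + (1 - \<theta>) r\<close>. The sum of the
  two bounds is \<open>r + s + t\<close>, so \<open>A\<close> costs no more than \<open>P\<close>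
  (\<open>stationary_bound\<close>). Since \<open>P\<close> is a minimizer, equality holds throughout, and this forces
  all angles to be 60 degrees and \<open>P\<close> to be the centroid (\<open>nonvertex_minimizer\<close>). In every other
  case only vertices can be minimizers, and comparing their costs finishes the proof.

  Equiangular lines at angle \<open>\<phi>\<close> below 60 degrees. The square of the cost is bounded below by a
  quadratic polynomial in \<open>a \<bullet> p\<close>, \<open>b \<bullet> p\<close>, \<open>c \<bullet> p\<close>; on the unit sphere this polynomial is at least
  \<open>6 - 6 cos \<phi>\<close>, with equality only if the three numbers agree (\<open>equiangular_bound\<close>). The
  centroid attains this value.
\<close>

section \<open>Polynomial inequalities for the three distances\<close>

text \<open>At a stationary point the inequality \<open>a \<bullet> b \<le> 1/2\<close> can be expressed in the distances \<open>r\<close>, \<open>s\<close>,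
  \<open>t\<close> alone. The inequality \<open>0 \<le> pair_gap r s t\<close> is this condition with \<open>xy\<close> weakened to
  \<open>(x\<^sup>2 + y\<^sup>2)/2\<close>, where \<open>x\<close>, \<open>y\<close>, \<open>z\<close> are the cosines belonging to the sines \<open>r\<close>, \<open>s\<close>, \<open>t\<close>.\<close>

definition pair_gap where "pair_gap r s t = 3*(r^2+s^2) + 2*r * s*(1+t^2) - 2 - 4*r^2 * s^2 - 2*r * s*(r^2+s^2)" for r s t :: real

text \<open>The hypothesis on \<open>2xy(g - xy)\<close> is the law of cosines for the triangle formed by the three
  tangent vectors.\<close>

lemma pair_gap_nonneg:
  fixes r s t x y z g :: real
  assumes "x^2 = 1-r^2" "y^2 = 1-s^2" "z^2 = 1-t^2" "0 \<le> x" "0 \<le> y"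
    and rel: "2*x*y*(g - x*y) = r * s*(z^2-x^2-y^2)" and "g \<le> 1/2"
  shows "0 \<le> pair_gap r s t"
proof -
  have "2*(x*y)*g \<le> 2*(x*y)*(1/2)" using assms by (intro mult_left_mono) auto
  then have "r * s*(z^2-x^2-y^2) \<le> x*y - 2*(x^2*y^2)"
    unfolding rel[symmetric] by (simp add: algebra_simps power2_eq_square)
  moreover have "2*(x*y) \<le> x^2+y^2" using sum_squares_bound[of x y] by simp
  ultimately have "2*(r * s*(z^2-x^2-y^2)) \<le> x^2+y^2 - 4*(x^2*y^2)" by linarith
  then show ?thesis unfolding assms(1-3) pair_gap_def by (simp add: algebra_simps power2_eq_square)
qed

lemma second_ge_half:
  fixes r s t :: real
  assumes "0 \<le> r" "r \<le> s" "0 \<le> t" "t \<le> 1" and R: "0 \<le> pair_gap r s t"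
  shows "1/2 \<le> s"
proof (rule ccontr)
  assume "\<not> 1/2 \<le> s"
  then have s: "0 \<le> s" "s < 1/2" using assms by auto
  define P where "P = r * s"
  have P: "0 \<le> P" "P < 1/4"
    using assms s mult_mono[of r "s" s s] mult_strict_mono[of s "1/2" s "1/2"] by (auto simp: P_def)
  have sq: "r^2 + s^2 \<le> 1/2"
    using power_mono[of r "1/2" 2] power_mono[of s "1/2" 2] assms s by (simp add: power2_eq_square)
  have "(3-2*P)*(r^2+s^2) \<le> (3-2*P)*(1/2)" using P sq by (intro mult_left_mono) auto
  moreover have "P*t^2 \<le> P*1" using P assms by (intro mult_left_mono) (auto simp: power_le_one)
  moreover have "(1-4*P)*(1-2*P) > 0" using P by simp
  moreover have "pair_gap r s t = (3-2*P)*(r^2+s^2) + 2*P + 2*(P*t^2) - 2 - 4*P^2"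
    unfolding pair_gap_def P_def by algebra
  moreover have "(1-4*P)*(1-2*P) = 1 - 6*P + 8*P^2" by algebra
  moreover have "(3-2*P)*(1/2) = 3/2-P" by simp
  ultimately show False using R by linarith
qed

text \<open>This inequality and the next are what remains of the two side bounds. On the diagonal
  \<open>r = s = t\<close> the difference of the two sides equals \<open>3 * pair_gap\<close>, which vanishes at
  \<open>r\<^sup>2 = 1/3\<close>. Subtracting that multiple off the diagonal too leaves terms with a factor
  \<open>s - r\<close> or \<open>t - s\<close> whose cofactors are nonnegative, except in a region where the
  distances are large; there a crude estimate suffices.\<close>

lemma nearest_pair_ineq:
  fixes r s t :: real
  assumes "0 \<le> r" "r \<le> s" "s \<le> t" "t \<le> 1" and R: "0 \<le> pair_gap r s t"
  shows "2*(1-t^2)*(2-r^2+s^2) \<le> (5 * s^2+4*r * s-1)*(2-r^2-s^2)"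
proof -
  have sq: "r^2 \<le> s^2" "s^2 \<le> t^2" "t^2 \<le> 1" "r * s \<le> s^2" "0 \<le> r * s" "0 \<le> r^2"
    using assms by (auto simp: power2_eq_square intro: mult_mono mult_le_one)
  show ?thesis
  proof (cases "s^2 \<le> 2/3")
    case True
    have f: "0 \<le> 2-r^2+s^2-3*r * s" "0 \<le> t^2-s^2" "0 \<le> 4-3 * s^2-2*r^2" "0 \<le> 6-7 * s^2"
      using sq True by linarith+
    have "0 \<le> (2-r^2+s^2-3*r * s)*(t^2-s^2)" using f by simp
    moreover have "0 \<le> s*(4-3 * s^2-2*r^2) + r*(6-7 * s^2)"
      using f assms by (intro add_nonneg_nonneg mult_nonneg_nonneg) auto
    then have "0 \<le> (s-r)*(s*(4-3 * s^2-2*r^2) + r*(6-7 * s^2))"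
      using assms by (intro mult_nonneg_nonneg) auto
    moreover have "(5 * s^2+4*r * s-1)*(2-r^2-s^2) - 2*(1-t^2)*(2-r^2+s^2) =
        3*pair_gap r s t + 2*((2-r^2+s^2-3*r * s)*(t^2-s^2)) + (s-r)*(s*(4-3 * s^2-2*r^2) + r*(6-7 * s^2))"
      unfolding pair_gap_def by algebra
    ultimately show ?thesis using R by linarith
  next
    case False
    define m where "m = 1-s^2"
    define n where "n = 1-r^2"
    have mn: "0 \<le> m" "m \<le> 1/3" "m \<le> n" using False sq by (auto simp: m_def n_def)
    have "2*(1-t^2)*(2-r^2+s^2) \<le> 2*m*(2-r^2+s^2)"
      using sq by (intro mult_right_mono) (auto simp: m_def)
    also have "\<dots> = 4*m - 2*m^2 + 2*(m*n)" unfolding m_def n_def by algebra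
    also have "\<dots> \<le> 4*m + 2/3*n"
      using mult_right_mono[of m "1/3" n] mn zero_le_power2[of m] by linarith
    also have "\<dots> \<le> 7/3*(m+n)" using mn by simp
    also have "\<dots> = 7/3*(2-r^2-s^2)" by (simp add: m_def n_def)
    also have "\<dots> \<le> (5 * s^2+4*r * s-1)*(2-r^2-s^2)"
      using False sq by (intro mult_right_mono) auto
    finally show ?thesis .
  qed
qed

text \<open>Here the cofactors are nonnegative for \<open>r \<le> 1/3\<close>, and for \<open>r\<^sup>2 \<le> 1/3\<close> as long as \<open>t\<^sup>2 \<le> 3/5\<close>.
  When \<open>r\<^sup>2 \<ge> 1/3\<close> the crude bound \<open>1 - s\<^sup>2 \<le> 1 - r\<^sup>2\<close> suffices, and in the remaining region
  \<open>1 - s\<^sup>2 \<le> 3/4\<close> does.\<close>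

lemma farthest_pair_ineq:
  fixes r s t :: real
  assumes "0 \<le> r" "r \<le> s" "s \<le> t" "t \<le> 1" and R: "0 \<le> pair_gap r s t"
  shows "2*(1-s^2)*(2-r^2+t^2) \<le> (5*t^2+4*r*t-1)*(2-r^2-t^2)"
proof -
  have s: "1/2 \<le> s" using second_ge_half[of r s t] assms by auto
  have sq: "r^2 \<le> s^2" "s^2 \<le> t^2" "t^2 \<le> 1" "r * s \<le> r*t" "r^2 \<le> r*t" "0 \<le> r * s" "0 \<le> r^2" "1/4 \<le> s^2"
    using assms s power_mono[of "1/2" s 2]
    by (auto simp: power2_eq_square intro: mult_mono mult_le_one mult_left_mono)
  define F where "F = t*(4-3*t^2-2*r^2) + r*(6-7*t^2)"
  define G where "G = (t+s)*(5-2*t^2-10*r^2-6*r * s)+6*r-6*r^3"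
  have ident: "(5*t^2+4*r*t-1)*(2-r^2-t^2) - 2*(1-s^2)*(2-r^2+t^2) =
      3*pair_gap r s t + (s-r)*F + (t-s)*(F+G)"
    unfolding pair_gap_def F_def G_def by algebra
  have FG: ?thesis if "0 \<le> F" "0 \<le> F + G"
  proof -
    have "0 \<le> (s-r)*F" "0 \<le> (t-s)*(F+G)" using that assms by auto
    then show ?thesis using ident R by linarith
  qed
  consider "1/3 \<le> r^2" | "r \<le> 1/3" | "1/3 \<le> r" "r^2 \<le> 1/3" "t^2 \<le> 3/5"
    | "1/3 \<le> r" "r^2 \<le> 1/3" "3/5 \<le> t^2" by linarith
  then show ?thesis
  proof cases
    case 1
    define m where "m = 1-t^2"
    define n where "n = 1-r^2"
    have mn: "0 \<le> m" "m \<le> n" "n \<le> 2/3" using 1 sq by (auto simp: m_def n_def)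
    have "2*(1-s^2)*(2-r^2+t^2) \<le> 2*n*(2-r^2+t^2)"
      using sq by (intro mult_right_mono) (auto simp: n_def)
    also have "\<dots> = 2*n*(2+n-m)" by (simp add: m_def n_def)
    also have "\<dots> \<le> (8-5*m-4*n)*(m+n)"
    proof -
      have "0 \<le> m*(8-5*m-7*n)" "0 \<le> n*(4-6*n)" using mn by (auto intro!: mult_nonneg_nonneg)
      moreover have "(8-5*m-4*n)*(m+n) - 2*n*(2+n-m) = m*(8-5*m-7*n) + n*(4-6*n)" by algebra
      ultimately show ?thesis by linarith
    qed
    also have "\<dots> = (5*t^2+4*r^2-1)*(2-r^2-t^2)" by (simp add: m_def n_def algebra_simps)
    also have "\<dots> \<le> (5*t^2+4*r*t-1)*(2-r^2-t^2)"
      using sq by (intro mult_right_mono) auto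
    finally show ?thesis .
  next
    case 2
    have r2: "r^2 \<le> 1/9" using power_mono[of r "1/3" 2] assms 2 by (simp add: power2_eq_square)
    have "r * s \<le> r*1" using assms by (intro mult_left_mono) auto
    then have A: "-r/3 \<le> 5-2*t^2-10*r^2-6*r * s" using sq r2 2 by simp
    have "(t+s)*(-r/3) \<le> (t+s)*(5-2*t^2-10*r^2-6*r * s)"
      using A assms by (intro mult_left_mono) auto
    moreover have "(t+s)*(r/3) \<le> 2*(r/3)" using assms by (intro mult_right_mono) auto
    moreover have "r^3 \<le> r*(1/9)" using mult_left_mono[OF r2, of r] assms by (simp add: power3_eq_cube power2_eq_square)
    ultimately have G: "0 \<le> G" unfolding G_def using assms by simp
    have "t*(7/9) \<le> t*(4-3*t^2-2*r^2)" using sq r2 assms by (intro mult_left_mono) auto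
    moreover have "r*(-1) \<le> r*(6-7*t^2)" using sq assms by (intro mult_left_mono) auto
    ultimately have "0 \<le> F" unfolding F_def using 2 s assms by linarith
    with G show ?thesis by (intro FG) auto
  next
    case 3
    have t1: "t*(10/3-3*t^2) \<le> t*(4-3*t^2-2*r^2)" using 3 assms by (intro mult_left_mono) auto
    have t2: "t*(23/15) \<le> t*(10/3-3*t^2)" using 3 assms by (intro mult_left_mono) auto
    have r2: "r*(9/5) \<le> r*(6-7*t^2)" using 3 assms by (intro mult_left_mono) auto
    have F: "0 \<le> F" unfolding F_def using t1 t2 r2 assms by linarith
    have r3: "r^3 \<le> r*(1/3)" using mult_left_mono[OF 3(2), of r] assms by (simp add: power3_eq_cube power2_eq_square)
    define P where "P = 5/3-2*t^2-6*r*t"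
    have "P \<le> 5-2*t^2-10*r^2-6*r * s" unfolding P_def using 3 sq by linarith
    then have P: "(t+s)*P \<le> (t+s)*(5-2*t^2-10*r^2-6*r * s)" using assms by (intro mult_left_mono) auto
    have "0 \<le> F + G"
    proof (cases "0 \<le> P")
      case True
      then have "0 \<le> (t+s)*P" using assms by (intro mult_nonneg_nonneg) auto
      then show ?thesis unfolding G_def using P F r3 assms by linarith
    next
      case False
      then have "(2*t)*P \<le> (t+s)*P" using assms by (intro mult_right_mono_neg) auto
      moreover have "0 \<le> t*(37/15) - r*(7/5)" using assms by simp
      moreover have "t*(37/15) \<le> t*(20/3-7*t^2)" using 3 assms by (intro mult_left_mono) auto
      moreover have "r*(-7/5) \<le> r*(10-19*t^2)" using 3 assms by (intro mult_left_mono) auto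
      moreover have "t*(10/3-3*t^2) + r*(6-7*t^2) + (2*t)*P + 4*r = t*(20/3-7*t^2) + r*(10-19*t^2)"
        unfolding P_def by algebra
      ultimately show ?thesis unfolding F_def G_def using P t1 r3 assms by linarith
    qed
    with F show ?thesis by (rule FG)
  next
    case 4
    \<comment> \<open>\<open>W\<close> is a line in \<open>C\<close> below the concave function \<open>sqrt C = t\<close>. With \<open>s\<close> bounded by \<open>1/2\<close>
      and \<open>t\<close> by \<open>W\<close>, the difference of the two sides becomes \<open>2 * h r\<close>. The cubic \<open>h\<close> is concave
      on \<open>1/3 \<le> r \<le> 29/50\<close>, an interval reaching just beyond \<open>1/sqrt 3\<close>, so its end points decide.\<close>
    define C where "C = t^2"
    define W where "W = 39/100 + 3/5*C"
    define h where "h = (\<lambda>u::real. (2-C-u^2)*(5/2*C-5/4+2*u*W) - 3/2*C)"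
    have C: "3/5 \<le> C" "C \<le> 1" using 4 sq by (auto simp: C_def)
    have CC: "0 \<le> (C-3/5)*(1-C)" using C by (intro mult_nonneg_nonneg) auto
    have ru: "r \<le> 29/50"
    proof (rule power2_le_imp_le)
      show "r^2 \<le> (29/50)^2" using 4 by (simp add: power2_eq_square)
    qed simp
    have t: "77/100 \<le> t"
    proof (rule power2_le_imp_le)
      show "(77/100)^2 \<le> t^2" using 4 by (simp add: power2_eq_square)
    qed (use assms in simp)
    have W: "W \<le> t"
    proof -
      have "0 \<le> (t-77/100)*(1-t)" using t assms by (intro mult_nonneg_nonneg) auto
      moreover have "t - W = 3/5*((t-77/100)*(1-t)) + (9/125 - 31/500*t)"
        unfolding W_def C_def by algebra
      ultimately show ?thesis using assms by linarith
    qed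
    have he: "h (1/3) = -29/10*C^2 + 4471/900*C - 187/100"
      "h (29/50) = -3196/1000*C^2 + 46144656/10000000*C - 132688736/100000000"
      unfolding h_def W_def by algebra+
    have "(C-3/5)*(1-C) = 8/5*C - 3/5 - C^2" by algebra
    then have C2: "C^2 \<le> 8/5*C - 3/5" using CC by linarith
    have h0: "0 \<le> h (1/3)" using he(1) C C2 by linarith
    have h1: "0 \<le> h (29/50)" using he(2) C C2 by linarith
    have chord: "h r * (29/50-1/3) = h (1/3)*(29/50-r) + h (29/50)*(r-1/3)
        + (29/50-1/3)*((r-1/3)*(29/50-r)*(2*W*(r+29/50+1/3)+5/2*C-5/4))"
      unfolding h_def by algebra
    have "0 \<le> W*(r+29/50+1/3)" using C assms by (intro mult_nonneg_nonneg) (auto simp: W_def)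
    then have "0 \<le> 2*W*(r+29/50+1/3)+5/2*C-5/4" using C by linarith
    then have "0 \<le> h r * (29/50-1/3)"
      unfolding chord using h0 h1 4 ru
      by (intro add_nonneg_nonneg mult_nonneg_nonneg) auto
    then have hr: "0 \<le> h r" by (simp add: zero_le_mult_iff)
    have "h r \<le> (2-C-r^2)*(5/2*C-5/4+2*r*t) - 3/2*C"
      unfolding h_def using W assms C 4 by (intro diff_right_mono mult_left_mono add_left_mono) auto
    then have "0 \<le> (2-C-r^2)*(5/2*C-5/4+2*r*t) - 3/2*C" using hr by linarith
    then have "0 \<le> 2*((2-C-r^2)*(5/2*C-5/4+2*r*t) - 3/2*C)" by simp
    also have "\<dots> = (5*t^2+4*r*t-1)*(2-r^2-t^2) - 3/2*(2-r^2+t^2)"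
      unfolding C_def by algebra
    finally have "3/2*(2-r^2+t^2) \<le> (5*t^2+4*r*t-1)*(2-r^2-t^2)" by (simp only: diff_ge_0_iff_ge)
    moreover have "2*(1-s^2)*(2-r^2+t^2) \<le> 3/2*(2-r^2+t^2)"
      using sq by (intro mult_right_mono) auto
    ultimately show ?thesis by linarith
  qed
qed


text \<open>In \<open>s + \<theta> r\<close> the coefficient \<open>\<theta>\<close> is chosen to cancel the linear term in \<open>r\<close>: the difference
  of the squares is \<open>r\<^sup>2\<close> times \<open>s\<^sup>2(1 + k\<^sup>2) + rs + \<theta>\<^sup>2 - 1\<close>, where \<open>-k\<close> is the cosine of the angle
  between the two tangent directions. At an angle of 120 degrees and \<open>s = t\<close> one has
  \<open>k = \<theta> = 1/2\<close>, so the squares are replaced by their tangents at \<open>1/2\<close>, and \<open>k\<close> by the lower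
  bound \<open>K\<close> that comes from \<open>2xy \<le> x\<^sup>2 + y\<^sup>2\<close>. What is left is the assumed polynomial inequality.\<close>

lemma side_le_weighted_sum:
  fixes x y z r s t g :: real
  assumes "x^2 = 1-r^2" "y^2 = 1-s^2" "z^2 = 1-t^2" "0 < r" "0 < s" "r < 1" "s \<le> 1" "0 \<le> x" "0 \<le> y"
    and rel: "2*x*y*(g - x*y) = r * s*(z^2-x^2-y^2)"
    and ineq: "2*(1-t^2)*(2-r^2+s^2) \<le> (5 * s^2+4*r * s-1)*(2-r^2-s^2)"
  defines "\<theta> \<equiv> (1+t^2-s^2)/2"
  shows "1 - g^2 \<le> (s + \<theta>*r)^2"
    and "1 - g^2 = (s + \<theta>*r)^2 \<Longrightarrow> \<theta> = 1/2 \<and> g = x*y - r * s/2"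
proof -
  define k where "k = (x*y - g)/(r * s)"
  have g: "g = x*y - r * s*k" using assms by (simp add: k_def)
  have "r * s*(2*x*y*k) = r * s*(x^2+y^2-z^2)" using rel unfolding g by (simp add: algebra_simps)
  then have k: "2*x*y*k = x^2+y^2-z^2" using assms by simp
  have "g^2 = x^2*y^2 - r * s*(2*x*y*k) + r^2 * s^2*k^2" unfolding g by algebra
  then have "g^2 = (1-r^2)*(1-s^2) - r * s*(1-r^2-s^2+t^2) + r^2 * s^2*k^2" unfolding k assms by algebra
  then have gap: "(s + \<theta>*r)^2 - (1-g^2) = r^2*(s^2*(1+k^2)+r * s+\<theta>^2-1)"
    unfolding \<theta>_def by (simp add: field_simps) algebra
  define D where "D = 2-r^2-s^2"
  have "r^2 < 1" "s^2 \<le> 1" using assms by (auto simp: power_le_one power_less_one_iff abs_square_less_1)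
  then have D: "0 < D" unfolding D_def by linarith
  define K where "K = (1-r^2-s^2+t^2)/D"
  have "1-r^2-s^2+t^2 = 2*x*y*k" using k assms by simp
  also have "\<dots> \<le> 2*x*y*\<bar>k\<bar>" using assms by (intro mult_left_mono) auto
  also have "\<dots> \<le> D*\<bar>k\<bar>" using sum_squares_bound[of x y] assms by (intro mult_right_mono) (auto simp: D_def)
  finally have K: "K \<le> \<bar>k\<bar>" unfolding K_def using D by (simp add: field_simps)
  have "D*K = 1-r^2-s^2+t^2" using D by (simp add: K_def)
  then have "4*D*(s^2*(3/4+K)+r * s+\<theta>-5/4) = (5 * s^2+4*r * s-1)*(2-r^2-s^2) - 2*(1-t^2)*(2-r^2+s^2)"
    unfolding D_def \<theta>_def by algebra
  then have "0 \<le> 4*D*(s^2*(3/4+K)+r * s+\<theta>-5/4)" using ineq by simp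
  then have main: "0 \<le> s^2*(3/4+K)+r * s+\<theta>-5/4" using D by (simp add: zero_le_mult_iff)
  have decomp: "s^2*(1+k^2)+r * s+\<theta>^2-1
      = (s^2*(3/4+K)+r * s+\<theta>-5/4) + s^2*(\<bar>k\<bar>-K) + s^2*(\<bar>k\<bar>-1/2)^2 + (\<theta>-1/2)^2"
    using power2_abs[of k] by (simp add: algebra_simps power2_eq_square)
  have terms: "0 \<le> s^2*(\<bar>k\<bar>-K)" "0 \<le> s^2*(\<bar>k\<bar>-1/2)^2" "0 \<le> (\<theta>-1/2)^2" using K by auto
  have "0 \<le> r^2*(s^2*(1+k^2)+r * s+\<theta>^2-1)"
    unfolding decomp using main terms by (intro mult_nonneg_nonneg) auto
  then show "1 - g^2 \<le> (s + \<theta>*r)^2" using gap by linarith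
  assume "1 - g^2 = (s + \<theta>*r)^2"
  then have "s^2*(1+k^2)+r * s+\<theta>^2-1 = 0" using gap \<open>0 < r\<close> by simp
  then have z: "s^2*(\<bar>k\<bar>-1/2)^2 = 0" "(\<theta>-1/2)^2 = 0" unfolding decomp using main terms by linarith+
  then have \<theta>: "\<theta> = 1/2" and k2: "\<bar>k\<bar> = 1/2" using \<open>0 < s\<close> by auto
  have "2*x*y*k = 1 - r^2" using \<theta> k assms by (simp add: \<theta>_def)
  then have "0 < 2*x*y*k" using \<open>r^2 < 1\<close> by simp
  moreover have "2*x*y*k \<le> 0" if "k \<le> 0"
    using that assms by (intro mult_nonneg_nonpos) auto
  ultimately have "0 < k" by linarith
  then show "\<theta> = 1/2 \<and> g = x*y - r * s/2" using \<theta> k2 g by simp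
qed

section \<open>Stationary points of the cost\<close>

lemma unit_inner_square_le_1:
  fixes u v :: "'a::real_inner"
  assumes "norm u = 1" "norm v = 1"
  shows "(u \<bullet> v)^2 \<le> 1"
  using Cauchy_Schwarz_ineq2[of u v] assms by (simp add: abs_square_le_1)

text \<open>Were the gradient nonzero, moving \<open>p\<close> along the great circle in its direction would change
  the cost to first order.\<close>

lemma minimizer_is_stationary:
  fixes a b c p :: "'a::real_inner"
  defines "f \<equiv> \<lambda>q. sqrt (1 - (a \<bullet> q)^2) + sqrt (1 - (b \<bullet> q)^2) + sqrt (1 - (c \<bullet> q)^2)"
  assumes p: "norm p = 1" and lt1: "(a \<bullet> p)^2 < 1" "(b \<bullet> p)^2 < 1" "(c \<bullet> p)^2 < 1"
    and min: "\<And>q. norm q = 1 \<Longrightarrow> f p \<le> f q"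
  shows "((a \<bullet> p)/sqrt (1-(a \<bullet> p)^2)) *\<^sub>R (a - (a \<bullet> p) *\<^sub>R p)
    + ((b \<bullet> p)/sqrt (1-(b \<bullet> p)^2)) *\<^sub>R (b - (b \<bullet> p) *\<^sub>R p)
    + ((c \<bullet> p)/sqrt (1-(c \<bullet> p)^2)) *\<^sub>R (c - (c \<bullet> p) *\<^sub>R p) = 0" (is "?v = 0")
proof (rule ccontr)
  assume nz: "?v \<noteq> 0"
  have pp: "p \<bullet> p = 1" using p by (simp add: dot_square_norm)
  define u where "u = ?v /\<^sub>R norm ?v"
  have u: "norm u = 1" using nz by (simp add: u_def)
  have "?v \<bullet> p = 0" by (simp add: inner_add_left inner_diff_left pp)
  then have up: "u \<bullet> p = 0" "p \<bullet> u = 0" by (simp_all add: u_def inner_commute)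
  have "?v \<bullet> u = norm ?v" using nz by (simp add: u_def dot_square_norm power2_eq_square)
  then have vu: "(a \<bullet> p)/sqrt (1-(a \<bullet> p)^2) * (a \<bullet> u) + (b \<bullet> p)/sqrt (1-(b \<bullet> p)^2) * (b \<bullet> u)
      + (c \<bullet> p)/sqrt (1-(c \<bullet> p)^2) * (c \<bullet> u) \<noteq> 0"
    using nz by (simp add: inner_add_left inner_diff_left up)
  define g where "g = (\<lambda>t::real. cos t *\<^sub>R p + sin t *\<^sub>R u)"
  have "norm (g t) = 1" for t
  proof -
    have "u \<bullet> u = 1" using u by (simp add: dot_square_norm)
    then have "g t \<bullet> g t = (cos t)^2 + (sin t)^2"
      by (simp add: g_def inner_add_left inner_add_right up pp power2_eq_square)
    then show ?thesis by (simp add: norm_eq_sqrt_inner)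
  qed
  then have le: "f (g 0) \<le> f (g t)" for t using min by (simp add: g_def)
  have deriv: "((\<lambda>t. sqrt (1 - (d \<bullet> g t)^2)) has_real_derivative
      - ((d \<bullet> p)/sqrt (1-(d \<bullet> p)^2) * (d \<bullet> u))) (at 0)" if "(d \<bullet> p)^2 < 1" for d
    unfolding g_def inner_add_right inner_scaleR_right
    using that by (auto intro!: derivative_eq_intros simp: field_simps)
  have "((\<lambda>t. f (g t)) has_real_derivative
     - ((a \<bullet> p)/sqrt (1-(a \<bullet> p)^2) * (a \<bullet> u)) + - ((b \<bullet> p)/sqrt (1-(b \<bullet> p)^2) * (b \<bullet> u))
      + - ((c \<bullet> p)/sqrt (1-(c \<bullet> p)^2) * (c \<bullet> u))) (at 0)"
    unfolding f_def by (intro DERIV_add deriv lt1)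
  from DERIV_local_min[OF this, of 1] le vu show False by simp
qed


text \<open>The vector equation says that the gradient of the cost at \<open>p\<close> vanishes. Equating the
  norm of each summand with that of the sum of the other two ties the inner products of \<open>a\<close>, \<open>b\<close>, \<open>c\<close> to
  \<open>a \<bullet> p\<close>, \<open>b \<bullet> p\<close>, \<open>c \<bullet> p\<close>. Exchanging the two farther vertices replaces \<open>\<theta>\<close> by \<open>1 - \<theta>\<close>,
  so the two side bounds add up to the cost at \<open>p\<close>.\<close>

lemma stationary_bound:
  fixes a b c p :: "'a::real_inner"
  assumes unit: "norm a = 1" "norm b = 1" "norm c = 1" "norm p = 1"
    and pos: "0 \<le> a \<bullet> p" "0 \<le> b \<bullet> p" "0 \<le> c \<bullet> p"
  defines "r \<equiv> sqrt (1 - (a \<bullet> p)^2)" and "s \<equiv> sqrt (1 - (b \<bullet> p)^2)" and "t \<equiv> sqrt (1 - (c \<bullet> p)^2)"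
  assumes ord: "0 < r" "r \<le> s" "s \<le> t" "r < 1" and ab: "a \<bullet> b \<le> 1/2"
    and stat: "((a \<bullet> p)/r) *\<^sub>R (a - (a \<bullet> p) *\<^sub>R p) + ((b \<bullet> p)/s) *\<^sub>R (b - (b \<bullet> p) *\<^sub>R p)
      + ((c \<bullet> p)/t) *\<^sub>R (c - (c \<bullet> p) *\<^sub>R p) = 0"
  shows "sqrt (1 - (a \<bullet> b)^2) + sqrt (1 - (a \<bullet> c)^2) \<le> r + s + t"
    and "sqrt (1 - (a \<bullet> b)^2) + sqrt (1 - (a \<bullet> c)^2) = r + s + t \<Longrightarrow>
      a \<bullet> b = 1/2 \<and> a \<bullet> c = 1/2 \<and> b \<bullet> c = 1/2 \<and> (a \<bullet> p)^2 = 2/3 \<and> b \<bullet> p = a \<bullet> p \<and> c \<bullet> p = a \<bullet> p"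
proof -
  define x y z where "x = a \<bullet> p" and "y = b \<bullet> p" and "z = c \<bullet> p"
  have le1: "x^2 \<le> 1" "y^2 \<le> 1" "z^2 \<le> 1"
    using unit unfolding x_def y_def z_def by (auto intro!: unit_inner_square_le_1)
  have sq: "x^2 = 1-r^2" "y^2 = 1-s^2" "z^2 = 1-t^2"
    using le1 by (auto simp: r_def s_def t_def x_def y_def z_def)
  have xyz: "0 \<le> x" "0 \<le> y" "0 \<le> z" using pos by (auto simp: x_def y_def z_def)
  have t1: "t \<le> 1" by (simp add: t_def)
  define a' b' c' where "a' = (x/r) *\<^sub>R (a - x *\<^sub>R p)" and "b' = (y/s) *\<^sub>R (b - y *\<^sub>R p)"
    and "c' = (z/t) *\<^sub>R (c - z *\<^sub>R p)"
  have sum: "a' + b' + c' = 0" using stat by (simp add: a'_def b'_def c'_def x_def y_def z_def)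
  have unit': "a \<bullet> a = 1" "b \<bullet> b = 1" "c \<bullet> c = 1" "p \<bullet> p = 1" using unit by (auto simp: dot_square_norm)
  have ip: "a \<bullet> p = x" "p \<bullet> a = x" "b \<bullet> p = y" "p \<bullet> b = y" "c \<bullet> p = z" "p \<bullet> c = z"
    by (simp_all add: x_def y_def z_def inner_commute)
  have nrm: "a' \<bullet> a' = x^2" "b' \<bullet> b' = y^2" "c' \<bullet> c' = z^2"
  proof -
    have "(a - x *\<^sub>R p) \<bullet> (a - x *\<^sub>R p) = r^2" "(b - y *\<^sub>R p) \<bullet> (b - y *\<^sub>R p) = s^2" "(c - z *\<^sub>R p) \<bullet> (c - z *\<^sub>R p) = t^2"
      using sq by (simp_all add: inner_diff_left inner_diff_right unit' ip power2_eq_square)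
    then show "a' \<bullet> a' = x^2" "b' \<bullet> b' = y^2" "c' \<bullet> c' = z^2"
      using ord by (simp_all add: a'_def b'_def c'_def power2_eq_square)
  qed
  have prod: "a' \<bullet> b' = x*y/(r * s) * (a \<bullet> b - x*y)" "a' \<bullet> c' = x*z/(r*t) * (a \<bullet> c - x*z)" "b' \<bullet> c' = y*z/(s*t) * (b \<bullet> c - y*z)"
    by (simp_all add: a'_def b'_def c'_def inner_diff_left inner_diff_right unit' ip mult_ac)
  have twice: "2*(a' \<bullet> b') = z^2-x^2-y^2" "2*(a' \<bullet> c') = y^2-x^2-z^2" "2*(b' \<bullet> c') = x^2-y^2-z^2"
  proof -
    have neg: "c' = -(a'+b')" "b' = -(a'+c')" "a' = -(b'+c')"
      using sum by (simp_all only: eq_neg_iff_add_eq_0 ac_simps)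
    have sqm: "v \<bullet> v = w \<bullet> w" if "v = - w" for v w :: 'a using that by simp
    show "2*(a' \<bullet> b') = z^2-x^2-y^2" "2*(a' \<bullet> c') = y^2-x^2-z^2" "2*(b' \<bullet> c') = x^2-y^2-z^2"
      using sqm[OF neg(1)] sqm[OF neg(2)] sqm[OF neg(3)]
      by (simp_all add: nrm inner_add_left inner_add_right inner_commute)
  qed
  have aux: "2*m*n*h = q*w*D" if "e = m*n/(q*w)*h" "2*e = D" "0 < q" "0 < w" for m n h q w D e :: real
    using that by (auto simp: field_simps)
  have rel: "2*x*y*(a \<bullet> b - x*y) = r * s*(z^2-x^2-y^2)" "2*x*z*(a \<bullet> c - x*z) = r*t*(y^2-x^2-z^2)"
    "2*y*z*(b \<bullet> c - y*z) = s*t*(x^2-y^2-z^2)"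
    using aux[OF prod(1) twice(1)] aux[OF prod(2) twice(2)] aux[OF prod(3) twice(3)] ord by simp_all
  have R: "0 \<le> pair_gap r s t" by (rule pair_gap_nonneg[OF sq xyz(1,2) rel(1) ab])
  define \<theta> where "\<theta> = (1+t^2-s^2)/2"
  have near: "2*(1-t^2)*(2-r^2+s^2) \<le> (5 * s^2+4*r * s-1)*(2-r^2-s^2)"
    using nearest_pair_ineq[of r s t] R ord t1 by auto
  have far: "2*(1-s^2)*(2-r^2+t^2) \<le> (5*t^2+4*r*t-1)*(2-r^2-t^2)"
    using farthest_pair_ineq[of r s t] R ord t1 by auto
  have AB: "1 - (a \<bullet> b)^2 \<le> (s + \<theta>*r)^2" "1 - (a \<bullet> b)^2 = (s + \<theta>*r)^2 \<Longrightarrow> \<theta> = 1/2 \<and> a \<bullet> b = x*y - r * s/2"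
    unfolding \<theta>_def using side_le_weighted_sum[OF sq _ _ _ _ xyz(1,2) rel(1) near] ord t1 by auto
  have \<theta>': "(1+s^2-t^2)/2 = 1-\<theta>" by (simp add: \<theta>_def field_simps)
  have AC: "1 - (a \<bullet> c)^2 \<le> (t + (1-\<theta>)*r)^2" "1 - (a \<bullet> c)^2 = (t + (1-\<theta>)*r)^2 \<Longrightarrow> 1-\<theta> = 1/2 \<and> a \<bullet> c = x*z - r*t/2"
    using side_le_weighted_sum[OF sq(1,3,2) _ _ _ _ xyz(1,3) rel(2) far] ord t1 unfolding \<theta>' by auto
  have "0 \<le> s^2" "s^2 \<le> 1" "0 \<le> t^2" "t^2 \<le> 1" using ord t1 by (auto simp: power_le_one)
  then have "0 \<le> 1+t^2-s^2" "0 \<le> 1+s^2-t^2" by linarith+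
  then have "0 \<le> \<theta>" "0 \<le> 1-\<theta>" unfolding \<theta>'[symmetric] by (simp_all add: \<theta>_def)
  then have "0 \<le> \<theta>*r" "0 \<le> (1-\<theta>)*r" using ord(1) by (simp_all add: zero_le_mult_iff)
  then have nn: "0 \<le> s + \<theta>*r" "0 \<le> t + (1-\<theta>)*r" using ord(1-3) by linarith+
  have le: "sqrt (1 - (a \<bullet> b)^2) \<le> s + \<theta>*r" "sqrt (1 - (a \<bullet> c)^2) \<le> t + (1-\<theta>)*r"
    by (rule real_le_lsqrt[OF nn(1) AB(1)], rule real_le_lsqrt[OF nn(2) AC(1)])
  have split: "(s + \<theta>*r) + (t + (1-\<theta>)*r) = r + s + t" by (simp add: algebra_simps)
  show "sqrt (1 - (a \<bullet> b)^2) + sqrt (1 - (a \<bullet> c)^2) \<le> r + s + t" using le split by linarith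
  assume "sqrt (1 - (a \<bullet> b)^2) + sqrt (1 - (a \<bullet> c)^2) = r + s + t"
  then have eq: "sqrt (1 - (a \<bullet> b)^2) = s + \<theta>*r" "sqrt (1 - (a \<bullet> c)^2) = t + (1-\<theta>)*r" using le split by linarith+
  have "(a \<bullet> b)^2 \<le> 1" "(a \<bullet> c)^2 \<le> 1"
    using unit by (auto intro!: unit_inner_square_le_1)
  then have eq2: "1 - (a \<bullet> b)^2 = (s + \<theta>*r)^2" "1 - (a \<bullet> c)^2 = (t + (1-\<theta>)*r)^2"
    unfolding eq[symmetric] by auto
  have \<theta>: "\<theta> = 1/2" and g: "a \<bullet> b = x*y - r * s/2" "a \<bullet> c = x*z - r*t/2" using AB(2) AC(2) eq2 by auto
  have st: "t = s" using \<theta> ord unfolding \<theta>_def by (auto intro: power2_eq_imp_eq[of t s])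
  have "y = z" using sq(2,3) st xyz(2,3) by (intro power2_eq_imp_eq[of y z]) simp_all
  have "x^2 < 1 \<and> 0 < x^2" using sq(1) ord by (auto simp: power_less_one_iff abs_square_less_1)
  then have "0 < x" using xyz by (auto simp: less_le)
  have "r * s*(x*y) = r * s*x^2" using rel(1) g \<open>y = z\<close> by simp
  then have "x = y" using \<open>0 < x\<close> ord(1,2) by (simp add: power2_eq_square)
  then have rs: "r = s" using sq(1,2) ord(1,2) by (intro power2_eq_imp_eq[of r s]) simp_all
  have gx: "a \<bullet> b = 1 - 3/2*r^2" using g rs \<open>x = y\<close> sq by (simp add: power2_eq_square)
  have "1 - (1 - 3/2*r^2)^2 = (3/2*r)^2" using eq2(1) unfolding gx \<theta> rs by simp
  then have "r^2*(1 - 3*r^2) = 0" by (simp add: power2_eq_square algebra_simps)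
  then have r: "r^2 = 1/3" using ord by simp
  have "2*x^2*(x^2 - b \<bullet> c) = r^2*x^2" using rel(3) \<open>x = y\<close> \<open>y = z\<close> st rs by (simp add: power2_eq_square algebra_simps)
  then have "b \<bullet> c = 1/2" using sq r by (simp add: field_simps)
  then show "a \<bullet> b = 1/2 \<and> a \<bullet> c = 1/2 \<and> b \<bullet> c = 1/2 \<and> (a \<bullet> p)^2 = 2/3 \<and> b \<bullet> p = a \<bullet> p \<and> c \<bullet> p = a \<bullet> p"
    using g gx r sq(1) \<open>x = y\<close> \<open>y = z\<close> st rs by (simp add: x_def y_def z_def)
qed

section \<open>Equiangular lines\<close>

text \<open>Let \<open>x = a \<bullet> p\<close>, \<open>y = b \<bullet> p\<close> and \<open>k = a \<bullet> b\<close>. The reflection exchanging \<open>a\<close> and \<open>b\<close> carries the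
  component of \<open>p\<close> orthogonal to \<open>b\<close> to a vector orthogonal to \<open>a\<close>. The left-hand side is the
  inner product of that vector with the component of \<open>p\<close> orthogonal to \<open>a\<close>, so this is a
  Cauchy-Schwarz inequality. It is sharp when \<open>x = y\<close>. The defect is governed by the Gram
  determinant of \<open>a\<close>, \<open>b\<close>, \<open>p\<close>.\<close>

lemma inner_product_of_sines_ge:
  fixes x y k :: real
  assumes "x^2 \<le> 1" "y^2 \<le> 1" "k < 1" and gram: "0 \<le> 1 - k^2 + 2*k*x*y - x^2 - y^2"
  shows "1 - x*y - (x-y)^2/(1-k) \<le> sqrt (1-x^2) * sqrt (1-y^2)"
proof -
  define d q where "d = (x-y)^2" and "q = d/(1-k)"
  have d: "d = q*(1-k)" "0 \<le> q" using assms by (auto simp: q_def d_def)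
  have "(1-x*y-q)^2 - (1-x^2)*(1-y^2) = q^2 + d - 2*(1-x*y)*q" unfolding d_def by algebra
  also have "\<dots> = q*(q - 2*(1-x*y) + (1-k))" unfolding d by algebra
  also have "\<dots> \<le> 0"
  proof (rule mult_nonneg_nonpos)
    have "(1-k)*(q - 2*(1-x*y) + (1-k)) = - (1 - k^2 + 2*k*x*y - x^2 - y^2)"
      using d(1) unfolding d_def by algebra
    then have "(1-k)*(q - 2*(1-x*y) + (1-k)) \<le> 0" using gram by linarith
    then show "q - 2*(1-x*y) + (1-k) \<le> 0" using \<open>k < 1\<close> by (simp add: mult_le_0_iff)
  qed (rule d)
  finally have "(1-x*y-q)^2 \<le> (1-x^2)*(1-y^2)" by simp
  then show ?thesis unfolding real_sqrt_mult[symmetric] d_def[symmetric] q_def[symmetric] by (rule real_le_rsqrt)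
qed

lemma gram3_nonneg:
  fixes a b p :: "'a::real_inner"
  assumes "a \<bullet> a = 1" "b \<bullet> b = 1" "p \<bullet> p = 1" "\<bar>a \<bullet> b\<bar> < 1"
  shows "0 \<le> 1 - (a \<bullet> b)^2 + 2*(a \<bullet> b)*(a \<bullet> p)*(b \<bullet> p) - (a \<bullet> p)^2 - (b \<bullet> p)^2"
proof -
  define k x y where "k = a \<bullet> b" and "x = a \<bullet> p" and "y = b \<bullet> p"
  have ip: "a \<bullet> b = k" "b \<bullet> a = k" "a \<bullet> p = x" "p \<bullet> a = x" "b \<bullet> p = y" "p \<bullet> b = y"
    by (simp_all add: k_def x_def y_def inner_commute)
  define w where "w = (1-k^2) *\<^sub>R p - (x-k*y) *\<^sub>R a - (y-k*x) *\<^sub>R b"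
  have "w \<bullet> w = (1-k^2)*(1-k^2+2*k*x*y-x^2-y^2)"
    unfolding w_def by (simp add: inner_diff_left inner_diff_right assms ip) algebra
  then have "0 \<le> (1-k^2)*(1-k^2+2*k*x*y-x^2-y^2)" using inner_ge_zero[of w] by simp
  moreover have "0 < 1-k^2" using assms by (simp add: k_def abs_square_less_1)
  ultimately show ?thesis by (simp add: zero_le_mult_iff ip)
qed

text \<open>Expanding the square and bounding the three mixed products by the previous inequality gives
  \<open>9 - S\<^sup>2 - 6D/(1 - k)\<close> with \<open>S\<close> the sum of the three inner products. Since \<open>p\<close> is a unit vector,
  Bessel's inequality for the span of \<open>a\<close>, \<open>b\<close>, \<open>c\<close> bounds \<open>S\<^sup>2\<close>: in the eigenbasis
  of their Gram matrix it reads \<open>S\<^sup>2/(3(1 + 2k)) + D/(1 - k) \<le> 1\<close>.\<close>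

lemma equiangular_bound:
  fixes a b c p :: "'a::real_inner"
  assumes unit: "norm a = 1" "norm b = 1" "norm c = 1" "norm p = 1"
    and eq: "a \<bullet> b = k" "a \<bullet> c = k" "b \<bullet> c = k" and k: "1/2 \<le> k" "k < 1"
  defines "D \<equiv> (a \<bullet> p)^2 + (b \<bullet> p)^2 + (c \<bullet> p)^2 - (a \<bullet> p + b \<bullet> p + c \<bullet> p)^2/3"
  shows "6 - 6*k + (6*k-3)*(D/(1-k))
    \<le> (sqrt (1-(a \<bullet> p)^2) + sqrt (1-(b \<bullet> p)^2) + sqrt (1-(c \<bullet> p)^2))^2"
proof -
  define x y z where "x = a \<bullet> p" and "y = b \<bullet> p" and "z = c \<bullet> p"
  have unit': "a \<bullet> a = 1" "b \<bullet> b = 1" "c \<bullet> c = 1" "p \<bullet> p = 1" using unit by (auto simp: dot_square_norm)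
  have ip: "a \<bullet> p = x" "p \<bullet> a = x" "b \<bullet> p = y" "p \<bullet> b = y" "c \<bullet> p = z" "p \<bullet> c = z"
      "a \<bullet> b = k" "b \<bullet> a = k" "a \<bullet> c = k" "c \<bullet> a = k" "b \<bullet> c = k" "c \<bullet> b = k"
    using eq by (simp_all add: x_def y_def z_def inner_commute)
  have le1: "x^2 \<le> 1" "y^2 \<le> 1" "z^2 \<le> 1"
    using Cauchy_Schwarz_ineq2[of a p] Cauchy_Schwarz_ineq2[of b p] Cauchy_Schwarz_ineq2[of c p] unit
    by (simp_all add: x_def y_def z_def abs_square_le_1)
  have kk: "\<bar>k\<bar> < 1" using k by simp
  define q where "q = D/(1-k)"
  have D: "D = q*(1-k)" using k by (simp add: q_def)
  have pairs: "1 - x*y - (x-y)^2/(1-k) \<le> sqrt (1-x^2) * sqrt (1-y^2)"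
    "1 - x*z - (x-z)^2/(1-k) \<le> sqrt (1-x^2) * sqrt (1-z^2)"
    "1 - y*z - (y-z)^2/(1-k) \<le> sqrt (1-y^2) * sqrt (1-z^2)"
    using gram3_nonneg[of a b p] gram3_nonneg[of a c p] gram3_nonneg[of b c p] kk k le1
    by (auto intro!: inner_product_of_sines_ge simp: unit' ip)
  define S N where "S = x+y+z" and "N = x^2+y^2+z^2"
  have DN: "D = N - S^2/3" by (simp add: D_def S_def N_def ip)
  have "(x-y)^2/(1-k) + (x-z)^2/(1-k) + (y-z)^2/(1-k) = 3*q"
  proof -
    have "(x-y)^2 + (x-z)^2 + (y-z)^2 = 3*D" unfolding DN S_def N_def by algebra
    then show ?thesis by (simp add: q_def add_divide_distrib[symmetric])
  qed
  moreover have "(sqrt (1-x^2) + sqrt (1-y^2) + sqrt (1-z^2))^2 = 3 - N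
     + 2*(sqrt (1-x^2) * sqrt (1-y^2)) + 2*(sqrt (1-x^2) * sqrt (1-z^2)) + 2*(sqrt (1-y^2) * sqrt (1-z^2))"
    using le1 by (simp add: power2_eq_square algebra_simps N_def)
  moreover have "S^2 = N + 2*(x*y) + 2*(x*z) + 2*(y*z)" unfolding S_def N_def by algebra
  ultimately have J: "9 - S^2 - 6*q \<le> (sqrt (1-x^2) + sqrt (1-y^2) + sqrt (1-z^2))^2"
    using pairs by linarith
  define M where "M = (1-k)*(1+2*k)"
  define w where "w = M *\<^sub>R p - ((1+2*k)*x-k*S) *\<^sub>R a - ((1+2*k)*y-k*S) *\<^sub>R b - ((1+2*k)*z-k*S) *\<^sub>R c"
  have "w \<bullet> w = M*(M - ((1+2*k)*N - k*S^2))"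
    unfolding w_def by (simp add: inner_diff_left inner_diff_right unit' ip) (unfold M_def S_def N_def, algebra)
  then have "0 \<le> M*(M - ((1+2*k)*N - k*S^2))" using inner_ge_zero[of w] by simp
  moreover have "0 < M" using k by (simp add: M_def)
  ultimately have "0 \<le> M - ((1+2*k)*N - k*S^2)" by (simp add: zero_le_mult_iff)
  also have "\<dots> = (1-k)*((1+2*k) - (1+2*k)*q - S^2/3)" using D unfolding DN M_def by algebra
  finally have "S^2/3 \<le> (1+2*k) - (1+2*k)*q" using k by (simp add: zero_le_mult_iff)
  then have "6 - 6*k + (6*k-3)*q \<le> 9 - S^2 - 6*q" by (simp add: algebra_simps)
  then show ?thesis using J by (simp add: ip q_def)
qed

section \<open>The cost on the projective plane\<close>

lemma proj_dist_eq:
  assumes "unit_rep P u" "unit_rep Q v"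
  shows "proj_dist P Q = sqrt (1 - (u \<bullet> v)^2)"
  using unit_rep_inner_bound[OF assms]
  unfolding proj_dist_def proj_angle_eq[OF assms] by (simp add: sin_arccos)

lemma proj_dist_self: "proj_dist P P = 0"
proof -
  obtain u where u: "unit_rep P u" using unit_rep_exists by blast
  then have "u \<bullet> u = 1" by (simp add: unit_rep_def dot_square_norm)
  then show ?thesis using proj_dist_eq[OF u u] by simp
qed

lemma proj_angle_commute: "proj_angle P Q = proj_angle Q P"
proof -
  obtain u v where uv: "unit_rep P u" "unit_rep Q v" using unit_rep_exists by metis
  show ?thesis unfolding proj_angle_eq[OF uv] proj_angle_eq[OF uv(2,1)] by (simp add: inner_commute)
qed

lemma proj_dist_nonneg: "0 \<le> proj_dist P Q"
proof -
  have "proj_angle P Q \<le> pi" using proj_angle_bounds(2)[of P Q] pi_ge_zero by linarith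
  then show ?thesis unfolding proj_dist_def by (intro sin_ge_zero proj_angle_bounds(1))
qed

lemma proj_dist_commute: "proj_dist P Q = proj_dist Q P"
  unfolding proj_dist_def by (simp add: proj_angle_commute)

lemma unit_rep_point_exists:
  assumes "norm p = 1"
  shows "\<exists>P. unit_rep P p"
proof -
  have "p \<noteq> 0" using assms by auto
  then have "line_of (Abs_proj_plane (span {p})) = span {p}"
    by (subst Abs_proj_plane_inverse) auto
  then show ?thesis using assms unfolding unit_rep_def by blast
qed

lemma unit_rep_inj: "unit_rep P u \<Longrightarrow> unit_rep Q u \<Longrightarrow> P = Q"
  by (simp add: unit_rep_def line_of_inject[symmetric])

lemma proj_dist_pos:
  assumes "P \<noteq> Q"
  shows "0 < proj_dist P Q"
proof -
  obtain u v where uv: "unit_rep P u" "unit_rep Q v" using unit_rep_exists by metis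
  have n: "norm u = 1" "norm v = 1" using uv by (auto simp: unit_rep_def)
  have "(u \<bullet> v)^2 \<noteq> 1"
  proof
    assume "(u \<bullet> v)^2 = 1"
    moreover have "u \<bullet> u = 1" "v \<bullet> v = 1" using n by (simp_all add: dot_square_norm)
    ultimately have "(v - (u \<bullet> v) *\<^sub>R u) \<bullet> (v - (u \<bullet> v) *\<^sub>R u) = 0"
      by (simp add: inner_diff_left inner_diff_right inner_commute[of v u] power2_eq_square)
    then have "v = (u \<bullet> v) *\<^sub>R u" by simp
    moreover have "u \<bullet> v = 1 \<or> u \<bullet> v = -1" using \<open>(u \<bullet> v)^2 = 1\<close> by (simp add: power2_eq_1_iff)
    ultimately have "v = u \<or> v = - u" by (metis scaleR_one scaleR_minus1_left)
    then have "unit_rep P v" using unit_rep_iff[OF uv(1)] by blast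
    then show False using unit_rep_inj uv(2) assms by blast
  qed
  then have "(u \<bullet> v)^2 < 1" using unit_inner_square_le_1[OF n] by simp
  then show ?thesis unfolding proj_dist_eq[OF uv] by simp
qed

lemma cost_eq:
  assumes "unit_rep A a" "unit_rep B b" "unit_rep C c" "unit_rep P p"
  shows "cost A B C P = sqrt (1 - (a \<bullet> p)^2) + sqrt (1 - (b \<bullet> p)^2) + sqrt (1 - (c \<bullet> p)^2)"
  using assms by (simp add: cost_def proj_dist_eq)

lemma cost_vertex:
  "cost A B C A = proj_dist A B + proj_dist A C"
  "cost A B C B = proj_dist A B + proj_dist B C"
  "cost A B C C = proj_dist A C + proj_dist B C"
  by (simp_all add: cost_def proj_dist_self proj_dist_commute)

lemma minimizers_permute:
  "minimizers B A C = minimizers A B C" "minimizers A C B = minimizers A B C"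
  by (simp_all add: minimizers_def cost_def ac_simps)

lemma minimizers_nonempty: "minimizers A B C \<noteq> {}"
proof -
  obtain a b c where abc: "unit_rep A a" "unit_rep B b" "unit_rep C c" using unit_rep_exists by metis
  define f where "f = (\<lambda>q. sqrt (1 - (a \<bullet> q)^2) + sqrt (1 - (b \<bullet> q)^2) + sqrt (1 - (c \<bullet> q)^2))"
  have "continuous_on (sphere 0 1) f" unfolding f_def by (intro continuous_intros)
  moreover have "a \<in> sphere 0 1" using abc by (simp add: unit_rep_def)
  ultimately obtain p where p: "norm p = 1" "\<And>q. norm q = 1 \<Longrightarrow> f p \<le> f q"
    using continuous_attains_inf[of "sphere 0 1" f] by auto
  obtain P where P: "unit_rep P p" using unit_rep_point_exists p by blast
  have "cost A B C P \<le> cost A B C Q" for Q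
  proof -
    obtain q where q: "unit_rep Q q" using unit_rep_exists by blast
    then have "f p \<le> f q" using p by (simp add: unit_rep_def)
    then show ?thesis unfolding cost_eq[OF abc P] cost_eq[OF abc q] f_def .
  qed
  then show ?thesis by (auto simp: minimizers_def)
qed

text \<open>Choosing representatives with nonnegative inner product against \<open>p\<close> removes the absolute
  values from the angles at \<open>P\<close>.\<close>

lemma nonneg_rep_exists:
  assumes "unit_rep P p"
  shows "\<exists>a. unit_rep A a \<and> 0 \<le> a \<bullet> p"
proof -
  obtain a where a: "unit_rep A a" using unit_rep_exists by blast
  then have "unit_rep A (- a)" using unit_rep_iff by blast
  then show ?thesis using a by (cases "0 \<le> a \<bullet> p") auto
qed

lemma cos_le_half:
  assumes "pi/3 \<le> proj_angle P Q"
  shows "cos (proj_angle P Q) \<le> 1/2"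
  using cos_monotone_0_pi_le[of "pi/3" "proj_angle P Q"] assms proj_angle_bounds[of P Q] by (simp add: cos_60)

text \<open>The condition \<open>3x\<^sup>2 = 1 + 2k\<close> makes \<open>a + b + c\<close> as long as its projection onto \<open>p\<close>, hence
  parallel to \<open>p\<close>. The sign of \<open>x\<close> is free because \<open>p\<close> and \<open>-p\<close> represent the same point.\<close>

lemma centroid_criterion:
  assumes reps: "unit_rep A a" "unit_rep B b" "unit_rep C c" "unit_rep P p"
    and eq: "a \<bullet> b = k" "a \<bullet> c = k" "b \<bullet> c = k" "0 < k"
    and p: "a \<bullet> p = x" "b \<bullet> p = x" "c \<bullet> p = x" "3*x^2 = 1 + 2*k"
  shows "is_centroid A B C P"
proof -
  have unit: "a \<bullet> a = 1" "b \<bullet> b = 1" "c \<bullet> c = 1" "p \<bullet> p = 1" "norm p = 1"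
    using reps by (auto simp: unit_rep_def dot_square_norm)
  have ip: "b \<bullet> a = k" "c \<bullet> a = k" "c \<bullet> b = k" "p \<bullet> a = x" "p \<bullet> b = x" "p \<bullet> c = x"
    using eq p by (auto simp: inner_commute)
  define w where "w = a + b + c - (3*x) *\<^sub>R p"
  have "w \<bullet> w = 3 + 6*k - 9*x^2"
    unfolding w_def by (simp add: inner_diff_left inner_diff_right inner_add_left inner_add_right unit ip eq p power2_eq_square)
  then have "w \<bullet> w = 0" using p by simp
  then have "w = 0" by simp
  then have e: "a + b + c = (3*x) *\<^sub>R p" by (simp add: w_def)
  have "x \<noteq> 0" using p(4) eq(4) by auto
  then have "(a+b+c) /\<^sub>R norm (a+b+c) = p \<or> (a+b+c) /\<^sub>R norm (a+b+c) = - p"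
    unfolding e using unit by (cases "0 < x") auto
  then have "unit_rep P ((a+b+c) /\<^sub>R norm (a+b+c))" using unit_rep_iff[OF reps(4)] by blast
  moreover have "cos (proj_angle A B) = k" using cos_proj_angle[OF reps(1,2)] eq by simp
  ultimately show ?thesis unfolding is_centroid_def unit_rep_def[of P] using reps eq by blast
qed

lemma cost_centroid:
  assumes E: "is_centroid A B C E"
  shows "cost A B C E = sqrt (6 - 6 * cos (proj_angle A B))"
proof -
  define k where "k = cos (proj_angle A B)"
  obtain a b c where abc: "unit_rep A a" "unit_rep B b" "unit_rep C c"
      and eq: "a \<bullet> b = k" "a \<bullet> c = k" "b \<bullet> c = k" "0 < k"
      and line: "line_of E = span {(a + b + c) /\<^sub>R norm (a + b + c)}"
    using E unfolding is_centroid_def k_def by blast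
  have unit: "a \<bullet> a = 1" "b \<bullet> b = 1" "c \<bullet> c = 1" using abc by (auto simp: unit_rep_def dot_square_norm)
  have ip: "b \<bullet> a = k" "c \<bullet> a = k" "c \<bullet> b = k" using eq by (auto simp: inner_commute)
  define n where "n = norm (a+b+c)"
  have "n^2 = 3 + 6*k"
    unfolding n_def power2_norm_eq_inner by (simp add: inner_add_left inner_add_right unit ip eq)
  then have n: "n \<noteq> 0" "n^2 = 3*(1+2*k)" using eq by auto
  then have e: "unit_rep E ((a + b + c) /\<^sub>R n)" using line by (simp add: unit_rep_def n_def)
  have ae: "a \<bullet> ((a+b+c) /\<^sub>R n) = (1+2*k)/n" "b \<bullet> ((a+b+c) /\<^sub>R n) = (1+2*k)/n" "c \<bullet> ((a+b+c) /\<^sub>R n) = (1+2*k)/n"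
    by (simp_all add: inner_add_right unit ip eq divide_inverse)
  have m: "m^2/(3*m) = m/3" if "m \<noteq> 0" for m :: real using that by (simp add: power2_eq_square)
  have "((1+2*k)/n)^2 = (1+2*k)/3"
    unfolding power_divide n(2) by (rule m) (use eq(4) in linarith)
  then have "1 - ((1+2*k)/n)^2 = (6-6*k)/9" by simp
  then have "cost A B C E = 3 * sqrt ((6-6*k)/9)"
    unfolding cost_eq[OF abc e] ae by simp
  also have "\<dots> = sqrt (6-6*k)" by (simp add: real_sqrt_divide)
  finally show ?thesis by (simp add: k_def)
qed

lemma centroid_is_centroid:
  assumes "noncollinear A B C" "proj_angle A B = proj_angle A C" "proj_angle A C = proj_angle B C"
    and "proj_angle A B \<le> pi/3"
  shows "is_centroid A B C P \<longleftrightarrow> P = centroid A B C"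
proof
  note ex1 = is_centroid_ex1[OF assms]
  have c: "is_centroid A B C (centroid A B C)" unfolding centroid_def by (rule theI'[OF ex1])
  show "P = centroid A B C" if "is_centroid A B C P" using ex1 that c by metis
  show "is_centroid A B C P" if "P = centroid A B C" using c that by simp
qed

lemma noncollinear_distinct: "noncollinear A B C \<Longrightarrow> A \<noteq> B"
proof
  assume "noncollinear A B C" "A = B"
  then obtain a b c where abc: "unit_rep A a" "unit_rep A b" "distinct [a,b,c]" "independent {a,b,c}"
    unfolding noncollinear_def by blast
  then have "b = - a" using unit_rep_iff[OF abc(1), of b] by auto
  moreover have "a \<in> {a,b,c} - {b}" using abc(3) by simp
  ultimately have "b \<in> span ({a,b,c} - {b})" by (metis span_base span_neg)
  then show False using abc(4) unfolding dependent_def by blast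
qed

text \<open>In the equality case the bound leaves no room for a spread of the three inner products, and the
  value of the cost then fixes their common square.\<close>

lemma cost_lower_bound_equiangular:
  assumes E: "is_centroid A B C E" and k: "1/2 \<le> cos (proj_angle A B)" and "A \<noteq> B"
  shows "cost A B C E \<le> cost A B C P"
    and "1/2 < cos (proj_angle A B) \<Longrightarrow> cost A B C P = cost A B C E \<Longrightarrow> is_centroid A B C P"
proof -
  define k where "k = cos (proj_angle A B)"
  obtain a b c where abc: "unit_rep A a" "unit_rep B b" "unit_rep C c"
      and eq: "a \<bullet> b = k" "a \<bullet> c = k" "b \<bullet> c = k" "0 < k"
    using E unfolding is_centroid_def k_def by blast
  obtain p where p: "unit_rep P p" using unit_rep_exists by blast
  have unit: "norm a = 1" "norm b = 1" "norm c = 1" "norm p = 1"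
    using abc p by (auto simp: unit_rep_def)
  have "0 < 1 - k^2" using proj_dist_pos[OF \<open>A \<noteq> B\<close>] unfolding proj_dist_eq[OF abc(1,2)] eq by simp
  then have k1: "k < 1" using eq(4) by (simp add: power_less_one_iff abs_square_less_1)
  define x y z where "x = a \<bullet> p" and "y = b \<bullet> p" and "z = c \<bullet> p"
  define D where "D = x^2+y^2+z^2-(x+y+z)^2/3"
  have D: "3*D = (x-y)^2+(x-z)^2+(y-z)^2" unfolding D_def by algebra
  then have "0 \<le> 3*D" by simp
  then have D0: "0 \<le> D/(1-k)" using k1 by simp
  have bound: "6 - 6*k + (6*k-3)*(D/(1-k)) \<le> (cost A B C P)^2"
    using equiangular_bound[OF unit eq(1-3)] k k1 unfolding cost_eq[OF abc p] D_def x_def y_def z_def k_def by simp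
  have nn: "0 \<le> cost A B C P"
    unfolding cost_def by (intro add_nonneg_nonneg proj_dist_nonneg)
  have cE: "cost A B C E = sqrt (6-6*k)" using cost_centroid[OF E] by (simp add: k_def)
  have "0 \<le> (6*k-3)*(D/(1-k))" using k D0 by (intro mult_nonneg_nonneg) (auto simp: k_def)
  then have "6-6*k \<le> (cost A B C P)^2" using bound by linarith
  then show "cost A B C E \<le> cost A B C P" unfolding cE using nn by (simp add: real_le_lsqrt)
  assume k2: "1/2 < cos (proj_angle A B)" and "cost A B C P = cost A B C E"
  then have cP: "cost A B C P = sqrt (6-6*k)" using cE by simp
  then have "(cost A B C P)^2 = 6-6*k" using k1 by simp
  then have "(6*k-3)*(D/(1-k)) \<le> 0" using bound by linarith
  moreover have "0 < 6*k-3" using k2 by (simp add: k_def)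
  ultimately have "D/(1-k) \<le> 0" using mult_pos_pos by (meson not_le)
  then have "D = 0" using D0 k1 by simp
  then have "(x-y)^2+(x-z)^2+(y-z)^2 = 0" using D by simp
  then have xyz: "y = x" "z = x" by (auto simp: add_nonneg_eq_0_iff)
  have "x^2 \<le> 1" unfolding x_def by (rule unit_inner_square_le_1[OF unit(1,4)])
  have "cost A B C P = 3 * sqrt (1-x^2)"
    unfolding cost_eq[OF abc p] using xyz by (simp add: x_def y_def z_def)
  then have "6-6*k = 9*(1-x^2)" using \<open>(cost A B C P)^2 = 6-6*k\<close> \<open>x^2 \<le> 1\<close> by (simp add: power_mult_distrib)
  then have "3*x^2 = 1+2*k" by simp
  then show "is_centroid A B C P"
    using centroid_criterion[OF abc p eq] xyz by (simp add: x_def y_def z_def)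
qed

section \<open>Minimizers that are not vertices\<close>

text \<open>The lower bound on the angle enters through the two vertices nearest to \<open>P\<close>. That \<open>P\<close> costs
  no more than \<open>A\<close>, so at most 2, rules out the degenerate stationary point orthogonal to all three
  lines.\<close>

lemma nonvertex_minimizer_sorted:
  assumes P: "P \<in> minimizers A B C" "P \<noteq> A" "unit_rep P p"
    and sorted: "proj_dist A P \<le> proj_dist B P" "proj_dist B P \<le> proj_dist C P"
    and AB: "pi/3 \<le> proj_angle A B"
  shows "\<exists>a b c. unit_rep A a \<and> unit_rep B b \<and> unit_rep C c \<and> a \<bullet> b = 1/2 \<and> a \<bullet> c = 1/2 \<and> b \<bullet> c = 1/2
    \<and> (a \<bullet> p)^2 = 2/3 \<and> b \<bullet> p = a \<bullet> p \<and> c \<bullet> p = a \<bullet> p"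
proof -
  obtain a where a: "unit_rep A a" "0 \<le> a \<bullet> p" using nonneg_rep_exists[OF P(3)] by blast
  obtain b where b: "unit_rep B b" "0 \<le> b \<bullet> p" using nonneg_rep_exists[OF P(3)] by blast
  obtain c where c: "unit_rep C c" "0 \<le> c \<bullet> p" using nonneg_rep_exists[OF P(3)] by blast
  note abc = a(1) b(1) c(1) and nn = a(2) b(2) c(2)
  have unit: "norm a = 1" "norm b = 1" "norm c = 1" "norm p = 1"
    using abc P(3) by (auto simp: unit_rep_def)
  define r s t where "r = sqrt (1 - (a \<bullet> p)^2)" and "s = sqrt (1 - (b \<bullet> p)^2)" and "t = sqrt (1 - (c \<bullet> p)^2)"
  have d: "proj_dist A P = r" "proj_dist B P = s" "proj_dist C P = t"
    using abc P(3) by (simp_all add: proj_dist_eq r_def s_def t_def)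
  have "0 < r" using proj_dist_pos[of A P] P(2) d by auto
  have rst: "r \<le> s" "s \<le> t" using sorted d by auto
  have S: "cost A B C A = sqrt (1 - (a \<bullet> b)^2) + sqrt (1 - (a \<bullet> c)^2)"
    using abc by (simp add: cost_vertex proj_dist_eq)
  have J: "cost A B C P = r + s + t" by (simp add: cost_def d)
  have le: "r + s + t \<le> sqrt (1 - (a \<bullet> b)^2) + sqrt (1 - (a \<bullet> c)^2)"
    using P(1) unfolding minimizers_def S[symmetric] J[symmetric] by blast
  moreover have "sqrt (1 - (a \<bullet> b)^2) \<le> 1" "sqrt (1 - (a \<bullet> c)^2) \<le> 1" by simp_all
  ultimately have "r < 1" using rst by linarith
  have ab: "a \<bullet> b \<le> 1/2" using cos_le_half[OF AB] cos_proj_angle[OF abc(1,2)] by simp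
  have lt1: "(a \<bullet> p)^2 < 1" "(b \<bullet> p)^2 < 1" "(c \<bullet> p)^2 < 1"
    using \<open>0 < r\<close> rst real_sqrt_gt_0_iff less_le_trans[OF \<open>0 < r\<close> rst(1)]
      less_le_trans[OF less_le_trans[OF \<open>0 < r\<close> rst(1)] rst(2)] by (simp_all add: r_def s_def t_def)
  have min: "sqrt (1 - (a \<bullet> p)^2) + sqrt (1 - (b \<bullet> p)^2) + sqrt (1 - (c \<bullet> p)^2)
      \<le> sqrt (1 - (a \<bullet> q)^2) + sqrt (1 - (b \<bullet> q)^2) + sqrt (1 - (c \<bullet> q)^2)" if q: "norm q = 1" for q
  proof -
    obtain Q where "unit_rep Q q" using unit_rep_point_exists q by blast
    moreover have "cost A B C P \<le> cost A B C Q" using P(1) by (simp add: minimizers_def)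
    ultimately show ?thesis using cost_eq[OF abc P(3)] cost_eq[OF abc, of Q q] by simp
  qed
  have stat: "((a \<bullet> p)/r) *\<^sub>R (a - (a \<bullet> p) *\<^sub>R p) + ((b \<bullet> p)/s) *\<^sub>R (b - (b \<bullet> p) *\<^sub>R p)
      + ((c \<bullet> p)/t) *\<^sub>R (c - (c \<bullet> p) *\<^sub>R p) = 0"
    unfolding r_def s_def t_def by (rule minimizer_is_stationary[OF unit(4) lt1]) (rule min)
  note bound = stationary_bound[OF unit nn, folded r_def s_def t_def, OF \<open>0 < r\<close> rst \<open>r < 1\<close> ab stat]
  have "sqrt (1 - (a \<bullet> b)^2) + sqrt (1 - (a \<bullet> c)^2) = r + s + t" using bound(1) le by linarith
  from bound(2)[OF this] show ?thesis using abc by blast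
qed

text \<open>The sorted case gives a configuration that is symmetric in the three vertices, so the order of
  their distances to \<open>P\<close> does not matter.\<close>

lemma nonvertex_minimizer:
  assumes P: "P \<in> minimizers A B C" "P \<noteq> A" "P \<noteq> B" "P \<noteq> C"
    and ang: "pi/3 \<le> proj_angle A B" "pi/3 \<le> proj_angle A C" "pi/3 \<le> proj_angle B C"
  shows "is_centroid A B C P" "proj_angle A B = pi/3" "proj_angle A C = pi/3" "proj_angle B C = pi/3"
proof -
  obtain p where p: "unit_rep P p" using unit_rep_exists by blast
  define conf where "conf = (\<lambda>A B C. \<exists>a b c. unit_rep A a \<and> unit_rep B b \<and> unit_rep C c \<and> a \<bullet> b = 1/2
    \<and> a \<bullet> c = 1/2 \<and> b \<bullet> c = 1/2 \<and> (a \<bullet> p)^2 = 2/3 \<and> b \<bullet> p = a \<bullet> p \<and> c \<bullet> p = a \<bullet> p)"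
  have swap1: "conf A B C" if h: "conf B A C" for A B C
  proof -
    from h obtain a b c where "unit_rep A a" "unit_rep B b" "unit_rep C c" "b \<bullet> a = 1/2"
      "b \<bullet> c = 1/2" "a \<bullet> c = 1/2" "(b \<bullet> p)^2 = 2/3" "a \<bullet> p = b \<bullet> p" "c \<bullet> p = b \<bullet> p"
      unfolding conf_def by blast
    then have "unit_rep A a \<and> unit_rep B b \<and> unit_rep C c \<and> a \<bullet> b = 1/2
        \<and> a \<bullet> c = 1/2 \<and> b \<bullet> c = 1/2 \<and> (a \<bullet> p)^2 = 2/3 \<and> b \<bullet> p = a \<bullet> p \<and> c \<bullet> p = a \<bullet> p"
      by (simp add: inner_commute)
    then show ?thesis unfolding conf_def by blast
  qed
  have swap2: "conf A B C" if h: "conf A C B" for A B C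
  proof -
    from h obtain a b c where "unit_rep A a" "unit_rep B b" "unit_rep C c" "a \<bullet> c = 1/2"
      "a \<bullet> b = 1/2" "c \<bullet> b = 1/2" "(a \<bullet> p)^2 = 2/3" "c \<bullet> p = a \<bullet> p" "b \<bullet> p = a \<bullet> p"
      unfolding conf_def by blast
    then have "unit_rep A a \<and> unit_rep B b \<and> unit_rep C c \<and> a \<bullet> b = 1/2
        \<and> a \<bullet> c = 1/2 \<and> b \<bullet> c = 1/2 \<and> (a \<bullet> p)^2 = 2/3 \<and> b \<bullet> p = a \<bullet> p \<and> c \<bullet> p = a \<bullet> p"
      by (simp add: inner_commute)
    then show ?thesis unfolding conf_def by blast
  qed
  have srt: "conf A B C" if "P \<in> minimizers A B C" "P \<noteq> A" "pi/3 \<le> proj_angle A B"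
     "proj_dist A P \<le> proj_dist B P" "proj_dist B P \<le> proj_dist C P" for A B C
    unfolding conf_def using nonvertex_minimizer_sorted that p by blast
  have perm: "P \<in> minimizers A B C" "P \<in> minimizers B A C" "P \<in> minimizers A C B"
     "P \<in> minimizers C A B" "P \<in> minimizers B C A" "P \<in> minimizers C B A"
    using P(1) minimizers_permute by metis+
  have ang': "pi/3 \<le> proj_angle B A" "pi/3 \<le> proj_angle C A" "pi/3 \<le> proj_angle C B"
    using ang proj_angle_commute by metis+
  let ?d = "\<lambda>X. proj_dist X P"
  consider "?d A \<le> ?d B" "?d B \<le> ?d C" | "?d B \<le> ?d A" "?d A \<le> ?d C" | "?d A \<le> ?d C" "?d C \<le> ?d B"
    | "?d C \<le> ?d A" "?d A \<le> ?d B" | "?d B \<le> ?d C" "?d C \<le> ?d A" | "?d C \<le> ?d B" "?d B \<le> ?d A"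
    by linarith
  then have "conf A B C"
  proof cases
    case 1 then show ?thesis using srt[OF perm(1) P(2) ang(1)] by blast
  next
    case 2 then show ?thesis using swap1 srt[OF perm(2) P(3) ang'(1)] by blast
  next
    case 3 then show ?thesis using swap2 srt[OF perm(3) P(2) ang(2)] by blast
  next
    case 4 then show ?thesis using swap1 swap2 srt[OF perm(4) P(4) ang'(2)] by blast
  next
    case 5 then show ?thesis using swap1 swap2 srt[OF perm(5) P(3) ang(3)] by blast
  next
    case 6 then show ?thesis using swap1 swap2 srt[OF perm(6) P(4) ang'(3)] by blast
  qed
  then obtain a b c where abc: "unit_rep A a" "unit_rep B b" "unit_rep C c"
    and h: "a \<bullet> b = 1/2" "a \<bullet> c = 1/2" "b \<bullet> c = 1/2" "(a \<bullet> p)^2 = 2/3" "b \<bullet> p = a \<bullet> p" "c \<bullet> p = a \<bullet> p"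
    unfolding conf_def by blast
  show "is_centroid A B C P"
    using centroid_criterion[OF abc p h(1-3) _ refl h(5,6)] h(4) by simp
  have "arccos (1/2) = pi/3" using arccos_cos[of "pi/3"] by (simp add: cos_60)
  then show "proj_angle A B = pi/3" "proj_angle A C = pi/3" "proj_angle B C = pi/3"
    unfolding proj_angle_eq[OF abc(1,2)] proj_angle_eq[OF abc(1,3)] proj_angle_eq[OF abc(2,3)] h by simp_all
qed

section \<open>The three cases\<close>

lemma proj_dist_less_iff: "proj_dist P Q < proj_dist P' Q' \<longleftrightarrow> proj_angle P Q < proj_angle P' Q'"
proof -
  have "- (pi/2) \<le> proj_angle X Y" "proj_angle X Y \<le> pi/2" for X Y
    using proj_angle_bounds[of X Y] pi_ge_zero by linarith+
  then show ?thesis unfolding proj_dist_def by (intro sin_mono_less_eq)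
qed

theorem theorem1:
  fixes A B C :: proj_plane
  assumes "noncollinear A B C"
    and "proj_angle A B \<le> proj_angle A C"
    and "proj_angle A C \<le> proj_angle B C"
  shows
    "(pi / 3 \<le> proj_angle A B \<and> proj_angle A B \<le> proj_angle A C \<and>
        proj_angle A C < proj_angle B C
      \<longrightarrow> minimizers A B C = {A})
    \<and> (pi / 3 \<le> proj_angle A B \<and> proj_angle A B < proj_angle A C \<and>
        proj_angle A C = proj_angle B C
      \<longrightarrow> minimizers A B C = {A, B})
    \<and> (\<forall>\<phi>. proj_angle A B = \<phi> \<and> proj_angle A C = \<phi> \<and> proj_angle B C = \<phi> \<longrightarrow>
        (\<phi> > pi / 3 \<longrightarrow> minimizers A B C = {A, B, C})
      \<and> (\<phi> = pi / 3 \<longrightarrow> minimizers A B C = {A, B, C, centroid A B C})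
      \<and> (\<phi> < pi / 3 \<longrightarrow> minimizers A B C = {centroid A B C}))"
proof -
  have AB: "A \<noteq> B" by (rule noncollinear_distinct[OF assms(1)])
  have d: "proj_dist A B \<le> proj_dist A C" "proj_dist A C \<le> proj_dist B C"
    using assms(2,3) by (simp_all add: proj_dist_less_iff flip: not_less)
  have vertices: "minimizers A B C \<subseteq> {A,B,C} \<union> {P. is_centroid A B C P \<and>
      proj_angle A B = pi/3 \<and> proj_angle A C = pi/3 \<and> proj_angle B C = pi/3}" if "pi/3 \<le> proj_angle A B"
    using nonvertex_minimizer[of _ A B C] that assms(2,3) by fastforce
  have member: "X \<in> minimizers A B C \<longleftrightarrow> cost A B C X \<le> cost A B C P" if "P \<in> minimizers A B C" for P X
    using that unfolding minimizers_def by (auto intro: order_trans)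
  obtain P where P: "P \<in> minimizers A B C" using minimizers_nonempty by blast
  note costs = cost_vertex[of A B C]
  show ?thesis
  proof (intro conjI impI allI)
    assume h: "pi/3 \<le> proj_angle A B \<and> proj_angle A B \<le> proj_angle A C \<and> proj_angle A C < proj_angle B C"
    then have "proj_dist A C < proj_dist B C" by (simp add: proj_dist_less_iff)
    then have "cost A B C A < cost A B C B" "cost A B C A < cost A B C C" using costs d by linarith+
    then have "B \<notin> minimizers A B C" "C \<notin> minimizers A B C" unfolding minimizers_def by (auto simp: not_le)
    moreover have "minimizers A B C \<subseteq> {A,B,C}" using vertices h by auto
    ultimately show "minimizers A B C = {A}" using P by blast
  next
    assume h: "pi/3 \<le> proj_angle A B \<and> proj_angle A B < proj_angle A C \<and> proj_angle A C = proj_angle B C"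
    then have "proj_dist A B < proj_dist A C" by (simp add: proj_dist_less_iff)
    moreover have e: "proj_dist A C = proj_dist B C" using h by (simp add: proj_dist_def)
    ultimately have "cost A B C A < cost A B C C" using costs by linarith
    then have "C \<notin> minimizers A B C" unfolding minimizers_def by (auto simp: not_le)
    moreover have "minimizers A B C \<subseteq> {A,B,C}" using vertices h by auto
    moreover have "A \<in> minimizers A B C \<longleftrightarrow> B \<in> minimizers A B C"
      using costs e member[OF P] by simp
    ultimately show "minimizers A B C = {A, B}" using P by blast
  next
    fix \<phi> assume eq: "proj_angle A B = \<phi> \<and> proj_angle A C = \<phi> \<and> proj_angle B C = \<phi>"
    have same: "cost A B C B = cost A B C A" "cost A B C C = cost A B C A"
      using eq by (simp_all add: costs proj_dist_def)
    then have iff: "B \<in> minimizers A B C \<longleftrightarrow> A \<in> minimizers A B C" "C \<in> minimizers A B C \<longleftrightarrow> A \<in> minimizers A B C"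
      using member[OF P] by simp_all
    have cent: "is_centroid A B C X \<longleftrightarrow> X = centroid A B C" if "\<phi> \<le> pi/3" for X
      using centroid_is_centroid[OF assms(1)] eq that by simp
    {
      assume "\<phi> > pi/3"
      then have "minimizers A B C \<subseteq> {A,B,C}" using vertices eq by auto
      then show "minimizers A B C = {A,B,C}" using P iff by blast
    next
      assume 60: "\<phi> = pi/3"
      then have "minimizers A B C \<subseteq> {A,B,C,centroid A B C}" using vertices eq cent by auto
      moreover have "cost A B C (centroid A B C) = cost A B C A"
      proof -
        have "cost A B C (centroid A B C) = sqrt 3"
          using cost_centroid[of A B C "centroid A B C"] cent 60 eq by (simp add: cos_60)
        moreover have "proj_angle A B = pi/3" "proj_angle A C = pi/3" using eq 60 by auto
        then have "cost A B C A = sqrt 3" by (simp only: costs proj_dist_def sin_60)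
        ultimately show ?thesis by simp
      qed
      then have "centroid A B C \<in> minimizers A B C \<longleftrightarrow> A \<in> minimizers A B C" using member[OF P] by simp
      ultimately show "minimizers A B C = {A,B,C,centroid A B C}" using P iff by blast
    next
      assume lt: "\<phi> < pi/3"
      let ?E = "centroid A B C"
      have E: "is_centroid A B C ?E" using cent lt by simp
      have "cos (pi/3) < cos \<phi>" using lt eq proj_angle_bounds[of A B] cos_monotone_0_pi[of \<phi> "pi/3"] by simp
      then have k: "1/2 < cos (proj_angle A B)" using eq by (simp add: cos_60)
      have "?E \<in> minimizers A B C"
        unfolding minimizers_def using cost_lower_bound_equiangular(1)[OF E _ AB] k by simp
      moreover have "X = ?E" if "X \<in> minimizers A B C" for X
      proof -
        have "cost A B C X = cost A B C ?E"
          using that \<open>?E \<in> minimizers A B C\<close> unfolding minimizers_def by (auto intro: antisym)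
        then show ?thesis using cost_lower_bound_equiangular(2)[OF E _ AB k] k cent lt by simp
      qed
      ultimately show "minimizers A B C = {?E}" by blast
    }
  qed
qed

end
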